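(* Let $E, F$ be Banach lattices and let $X$ be a Banach space. (a) If $E^{*}$ has order continuous norm, then every positive almost Dunford-Pettis operator $T\colon E\longrightarrow F$ is positively limited, hence $T^{*} \colon F^* \longrightarrow E^*$ is almost Dunford-Pettis. (b) If $F$ has the dual positive Schur property, then every continuous operator $T\colon X\longrightarrow F$ is positively limited, hence $T^{*} \colon F^* \longrightarrow X^*$ is almost Dunford-Pettis.
   Context: Operators are linear. An operator from a Banach lattice to a Banach space is almost Dunford-Pettis if it sends disjoint weakly null sequences to norm null sequences (equivalently, positive disjoint weakly null sequences to norm null sequences). An operator $T$ from a Banach space $X$ to a Banach lattice $F$ is positively limited if $T^*$ takes positive weak$^*$-null sequences in $F^*$ to norm null sequences in $X^*$. A Banach lattice $F$ has the dual positive Schur property if every positive weak$^*$-null sequence in $F^*$ is norm null. *)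

theory Defs
  imports "HOL-Analysis.Analysis" "HOL-Library.Lattice_Algebras"
begin

section \<open>Banach lattices\<close>

class banach_lattice = banach + ordered_real_vector + lattice_ab_group_add_abs +
  assumes norm_mono_abs: "\<bar>x\<bar> \<le> \<bar>y\<bar> \<Longrightarrow> norm x \<le> norm y"

text \<open>
  The dual of a Banach lattice is the library type \<open>'a \<Rightarrow>\<^sub>L real\<close>. A type class instance
  cannot mention the type \<open>real\<close> as an argument, so the lattice structure is put on
  \<open>'a \<Rightarrow>\<^sub>L 'b\<close> for the codomains for which every bounded operator has a modulus of the same
  norm by the Riesz--Kantorovich argument: the Dedekind complete Banach lattices whose closed
  unit ball is an order interval \<open>{- e..e}\<close>. The real numbers are one of these.
\<close>

class unital_banach_lattice = banach_lattice + conditionally_complete_lattice +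
  assumes ex_strong_unit: "\<exists>e. \<forall>x. norm x \<le> 1 \<longleftrightarrow> \<bar>x\<bar> \<le> e"

instance real :: banach_lattice
  by standard simp

instance real :: unital_banach_lattice
  by standard (auto intro: exI[of _ 1])

definition strong_unit :: "'b::unital_banach_lattice" where
  "strong_unit = (SOME e. \<forall>x. norm x \<le> 1 \<longleftrightarrow> \<bar>x\<bar> \<le> e)"

lemma norm_le_1_iff_unit: "norm x \<le> 1 \<longleftrightarrow> \<bar>x\<bar> \<le> (strong_unit :: 'b::unital_banach_lattice)"
proof -
  have "\<forall>x::'b. norm x \<le> 1 \<longleftrightarrow> \<bar>x\<bar> \<le> strong_unit"
    unfolding strong_unit_def by (rule someI_ex) (rule ex_strong_unit)
  then show ?thesis by blast
qed

lemma strong_unit_nonneg: "0 \<le> (strong_unit :: 'b::unital_banach_lattice)"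
  using norm_le_1_iff_unit[of "0::'b"] by simp

lemma norm_le_unitI:
  fixes x :: "'b::unital_banach_lattice"
  assumes "x \<le> c *\<^sub>R strong_unit" "- x \<le> c *\<^sub>R strong_unit" "0 < c"
  shows "norm x \<le> c"
proof -
  have "(1/c) *\<^sub>R y \<le> strong_unit" if "y \<le> c *\<^sub>R strong_unit" for y :: 'b
    using scaleR_left_mono[OF that, of "1/c"] assms(3) by simp
  from this[of x] this[of "- x"] assms have "\<bar>(1/c) *\<^sub>R x\<bar> \<le> strong_unit"
    by (intro abs_leI) auto
  then have "norm ((1/c) *\<^sub>R x) \<le> 1"
    by (simp only: norm_le_1_iff_unit)
  then show ?thesis using assms(3) by (simp add: field_simps)
qed

lemma norm_le_unitI':
  fixes x :: "'b::unital_banach_lattice"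
  assumes x: "x \<le> c *\<^sub>R strong_unit" "- x \<le> c *\<^sub>R strong_unit" and c: "0 \<le> c"
  shows "norm x \<le> c"
proof (rule field_le_epsilon)
  fix d :: real assume d: "0 < d"
  have "c *\<^sub>R strong_unit \<le> (c + d) *\<^sub>R (strong_unit::'b)"
    using d strong_unit_nonneg by (intro scaleR_right_mono) auto
  with x c d show "norm x \<le> c + d"
    by (intro norm_le_unitI) auto
qed

lemma le_norm_unit:
  fixes x :: "'b::unital_banach_lattice"
  assumes "norm x \<le> c" shows "x \<le> c *\<^sub>R strong_unit"
proof (cases "c = 0")
  case True
  with assms have "x = 0" by simp
  then show ?thesis using True by simp
next
  case False
  with assms have c: "c > 0" using norm_ge_zero[of x] by linarith
  then have "norm ((1/c) *\<^sub>R x) \<le> 1" using assms by (simp add: field_simps)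
  then have "\<bar>(1/c) *\<^sub>R x\<bar> \<le> strong_unit" by (simp only: norm_le_1_iff_unit)
  then have "(1/c) *\<^sub>R x \<le> strong_unit" by (meson abs_ge_self order_trans)
  then have "c *\<^sub>R ((1/c) *\<^sub>R x) \<le> c *\<^sub>R strong_unit"
    using c by (intro scaleR_left_mono) auto
  then show ?thesis using c by simp
qed

lemma norm_mono_pos: "0 \<le> x \<Longrightarrow> x \<le> y \<Longrightarrow> norm x \<le> norm (y :: 'a::banach_lattice)"
  by (rule norm_mono_abs) (simp add: abs_of_nonneg order_trans[of 0 x y])

lemma norm_abs_eq: "norm \<bar>x\<bar> = norm (x :: 'a::banach_lattice)"
  by (rule antisym; rule norm_mono_abs) simp_all

lemma pprt_diff_pprt: "x = pprt x - pprt (- x :: 'a::lattice_ab_group_add)"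
  by (simp add: pprt_neg flip: prts)

lemma norm_pprt_le: "norm (pprt x) \<le> norm (x :: 'a::banach_lattice)"
proof -
  have "pprt x \<le> \<bar>x\<bar>"
    by (simp add: pprt_def abs_ge_self)
  from norm_mono_pos[OF _ this] show ?thesis by (simp add: norm_abs_eq)
qed


section \<open>The order of the space of bounded operators\<close>

instantiation blinfun :: (banach_lattice, banach_lattice) order
begin

definition less_eq_blinfun :: "('a \<Rightarrow>\<^sub>L 'b) \<Rightarrow> ('a \<Rightarrow>\<^sub>L 'b) \<Rightarrow> bool" where
  "f \<le> g \<longleftrightarrow> (\<forall>x\<ge>0. blinfun_apply f x \<le> blinfun_apply g x)"

definition less_blinfun :: "('a \<Rightarrow>\<^sub>L 'b) \<Rightarrow> ('a \<Rightarrow>\<^sub>L 'b) \<Rightarrow> bool" where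
  "less_blinfun f g \<longleftrightarrow> f \<le> g \<and> \<not> g \<le> f"

instance
proof
  fix f g h :: "'a \<Rightarrow>\<^sub>L 'b"
  show "f < g \<longleftrightarrow> f \<le> g \<and> \<not> g \<le> f" by (rule less_blinfun_def)
  show "f \<le> f" by (simp add: less_eq_blinfun_def)
  show "f \<le> g \<Longrightarrow> g \<le> h \<Longrightarrow> f \<le> h"
    unfolding less_eq_blinfun_def by (meson order_trans)
  show "f = g" if "f \<le> g" "g \<le> f"
  proof (rule blinfun_eqI)
    fix x
    have *: "blinfun_apply f y = blinfun_apply g y" if "0 \<le> y" for y
      using that \<open>f \<le> g\<close> \<open>g \<le> f\<close> unfolding less_eq_blinfun_def by (auto intro: antisym)
    have "blinfun_apply f (pprt x - pprt (- x)) = blinfun_apply g (pprt x - pprt (- x))"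
      by (simp only: blinfun.diff_right * zero_le_pprt)
    then show "blinfun_apply f x = blinfun_apply g x"
      by (simp only: pprt_diff_pprt[symmetric])
  qed
qed

end

instance blinfun :: (banach_lattice, banach_lattice) ordered_real_vector
proof
  fix f g h :: "'a \<Rightarrow>\<^sub>L 'b" and a b :: real
  show "f \<le> g \<Longrightarrow> h + f \<le> h + g"
    by (simp add: less_eq_blinfun_def blinfun.add_left)
  show "f \<le> g \<Longrightarrow> 0 \<le> a \<Longrightarrow> a *\<^sub>R f \<le> a *\<^sub>R g"
    by (simp add: less_eq_blinfun_def blinfun.scaleR_left scaleR_left_mono)
  show "a \<le> b \<Longrightarrow> 0 \<le> f \<Longrightarrow> a *\<^sub>R f \<le> b *\<^sub>R f"
    by (simp add: less_eq_blinfun_def blinfun.scaleR_left scaleR_right_mono)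
qed

subsection \<open>The positive part of a bounded operator (Riesz--Kantorovich formula)\<close>

definition rk_pos :: "('a::banach_lattice \<Rightarrow>\<^sub>L 'b::unital_banach_lattice) \<Rightarrow> 'a \<Rightarrow> 'b" where
  "rk_pos f x = Sup (blinfun_apply f ` {0..x})"

definition blinfun_pos :: "('a::banach_lattice \<Rightarrow>\<^sub>L 'b::unital_banach_lattice) \<Rightarrow> 'a \<Rightarrow>\<^sub>L 'b" where
  "blinfun_pos f = Blinfun (\<lambda>x. rk_pos f (pprt x) - rk_pos f (pprt (- x)))"

context
  fixes f :: "'a::banach_lattice \<Rightarrow>\<^sub>L 'b::unital_banach_lattice"
begin

lemma rk_bound:
  assumes "y \<in> {0..x}" shows "blinfun_apply f y \<le> (norm f * norm x) *\<^sub>R strong_unit"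
proof (rule le_norm_unit)
  have "norm y \<le> norm x" using assms by (auto intro: norm_mono_pos)
  with norm_blinfun[of f y] show "norm (blinfun_apply f y) \<le> norm f * norm x"
    by (meson mult_left_mono norm_ge_zero order_trans)
qed

lemma rk_upper: "y \<in> {0..x} \<Longrightarrow> blinfun_apply f y \<le> rk_pos f x"
  unfolding rk_pos_def by (intro cSup_upper bdd_aboveI2[OF rk_bound]) auto

lemma rk_least: "0 \<le> x \<Longrightarrow> (\<And>y. 0 \<le> y \<Longrightarrow> y \<le> x \<Longrightarrow> blinfun_apply f y \<le> z) \<Longrightarrow> rk_pos f x \<le> z"
  unfolding rk_pos_def by (intro cSup_least) auto

lemma rk_nonneg: "0 \<le> x \<Longrightarrow> 0 \<le> rk_pos f x"
  using rk_upper[of 0 x] by simp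

lemma norm_rk_le:
  assumes "0 \<le> x" shows "norm (rk_pos f x) \<le> norm f * norm x"
proof (rule norm_le_unitI')
  show "rk_pos f x \<le> (norm f * norm x) *\<^sub>R strong_unit"
    using assms rk_bound by (auto intro: rk_least)
  have "- rk_pos f x \<le> 0" using rk_nonneg[OF assms] by simp
  also have "0 \<le> (norm f * norm x) *\<^sub>R (strong_unit :: 'b)"
    by (intro scaleR_nonneg_nonneg strong_unit_nonneg) auto
  finally show "- rk_pos f x \<le> (norm f * norm x) *\<^sub>R strong_unit" .
qed auto

lemma rk_add:
  assumes x: "0 \<le> x" and y: "0 \<le> y" shows "rk_pos f (x + y) = rk_pos f x + rk_pos f y"
proof (rule antisym)
  show "rk_pos f (x + y) \<le> rk_pos f x + rk_pos f y"
  proof (rule rk_least)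
    fix z assume z: "0 \<le> z" "z \<le> x + y"
    define u where "u = inf z x"
    have "u \<in> {0..x}" using z x by (simp add: u_def)
    moreover have "z - u \<in> {0..y}"
      using z y by (simp add: u_def diff_inf_eq_sup add_sup_distrib_left algebra_simps)
    ultimately have "blinfun_apply f u + blinfun_apply f (z - u) \<le> rk_pos f x + rk_pos f y"
      by (intro add_mono rk_upper)
    then show "blinfun_apply f z \<le> rk_pos f x + rk_pos f y"
      by (simp add: blinfun.diff_right)
  qed (use x y in simp)
  have "rk_pos f x \<le> rk_pos f (x + y) - rk_pos f y"
  proof (rule rk_least[OF x])
    fix u assume u: "0 \<le> u" "u \<le> x"
    have "rk_pos f y \<le> rk_pos f (x + y) - blinfun_apply f u"
    proof (rule rk_least[OF y])
      fix v assume v: "0 \<le> v" "v \<le> y"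
      have "blinfun_apply f (u + v) \<le> rk_pos f (x + y)"
        using u v by (intro rk_upper) (auto intro: add_mono)
      then show "blinfun_apply f v \<le> rk_pos f (x + y) - blinfun_apply f u"
        by (simp add: blinfun.add_right algebra_simps)
    qed
    then show "blinfun_apply f u \<le> rk_pos f (x + y) - rk_pos f y"
      by (simp add: algebra_simps)
  qed
  then show "rk_pos f x + rk_pos f y \<le> rk_pos f (x + y)"
    by (simp add: algebra_simps)
qed

lemma rk_scale_le:
  assumes x: "0 \<le> x" and c: "0 < (c::real)" shows "rk_pos f (c *\<^sub>R x) \<le> c *\<^sub>R rk_pos f x"
proof (rule rk_least)
  fix z assume z: "0 \<le> z" "z \<le> c *\<^sub>R x"
  have "(1/c) *\<^sub>R z \<le> (1/c) *\<^sub>R (c *\<^sub>R x)" using z c by (intro scaleR_left_mono) auto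
  then have "(1/c) *\<^sub>R z \<in> {0..x}" using z c by (auto intro: scaleR_nonneg_nonneg)
  then have "c *\<^sub>R blinfun_apply f ((1/c) *\<^sub>R z) \<le> c *\<^sub>R rk_pos f x"
    using c by (intro scaleR_left_mono rk_upper) auto
  then show "blinfun_apply f z \<le> c *\<^sub>R rk_pos f x"
    using c by (simp add: blinfun.scaleR_right)
qed (use x c in \<open>simp add: scaleR_nonneg_nonneg\<close>)

lemma rk_scale:
  assumes x: "0 \<le> x" and c: "0 < (c::real)" shows "rk_pos f (c *\<^sub>R x) = c *\<^sub>R rk_pos f x"
proof (rule antisym[OF rk_scale_le[OF assms]])
  have "rk_pos f ((1/c) *\<^sub>R (c *\<^sub>R x)) \<le> (1/c) *\<^sub>R rk_pos f (c *\<^sub>R x)"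
    using x c by (intro rk_scale_le) (auto intro: scaleR_nonneg_nonneg)
  then have "rk_pos f x \<le> (1/c) *\<^sub>R rk_pos f (c *\<^sub>R x)" using c by simp
  then have "c *\<^sub>R rk_pos f x \<le> c *\<^sub>R ((1/c) *\<^sub>R rk_pos f (c *\<^sub>R x))"
    using c by (intro scaleR_left_mono) auto
  then show "c *\<^sub>R rk_pos f x \<le> rk_pos f (c *\<^sub>R x)" using c by simp
qed

lemma rk_diff:
  assumes "0 \<le> u" "0 \<le> v" "x = u - v"
  shows "rk_pos f (pprt x) - rk_pos f (pprt (- x)) = rk_pos f u - rk_pos f v"
proof -
  have "pprt x + v = u + pprt (- x)"
    using pprt_diff_pprt[of x] assms(3) by (metis add_diff_eq diff_add_cancel add.commute)
  then have "rk_pos f (pprt x + v) = rk_pos f (u + pprt (- x))" by simp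
  then have "rk_pos f (pprt x) + rk_pos f v = rk_pos f u + rk_pos f (pprt (- x))"
    using assms by (simp add: rk_add)
  then show ?thesis by (simp add: algebra_simps)
qed

lemma bounded_linear_rk: "bounded_linear (\<lambda>x. rk_pos f (pprt x) - rk_pos f (pprt (- x)))"
  (is "bounded_linear ?L")
proof (rule bounded_linear_intro[where K = "norm f + norm f"])
  fix x y :: 'a and c :: real
  have "?L (x + y) = rk_pos f (pprt x + pprt y) - rk_pos f (pprt (- x) + pprt (- y))"
  proof (rule rk_diff)
    have "x + y = (pprt x - pprt (- x)) + (pprt y - pprt (- y))"
      by (simp only: pprt_diff_pprt[symmetric])
    then show "x + y = pprt x + pprt y - (pprt (- x) + pprt (- y))"
      by (simp add: algebra_simps)
  qed (auto intro: add_nonneg_nonneg)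
  then show "?L (x + y) = ?L x + ?L y"
    by (simp add: rk_add)
  have pos: "?L (c *\<^sub>R x) = c *\<^sub>R ?L x" if "0 < c" for c x
  proof -
    have "?L (c *\<^sub>R x) = rk_pos f (c *\<^sub>R pprt x) - rk_pos f (c *\<^sub>R pprt (- x))"
      using that pprt_diff_pprt[of x]
      by (intro rk_diff) (auto simp flip: scaleR_diff_right intro: scaleR_nonneg_nonneg)
    then show ?thesis using that by (simp add: rk_scale scaleR_diff_right)
  qed
  have neg: "?L (- x) = - ?L x" for x by simp
  show "?L (c *\<^sub>R x) = c *\<^sub>R ?L x"
  proof (cases c "0::real" rule: linorder_cases)
    case less
    then have "?L ((- c) *\<^sub>R (- x)) = (- c) *\<^sub>R ?L (- x)" by (intro pos) simp
    then show ?thesis by (simp add: neg scaleR_diff_right)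
  next
    case equal
    then show ?thesis by simp
  qed (rule pos)
  have "norm (?L x) \<le> norm (rk_pos f (pprt x)) + norm (rk_pos f (pprt (- x)))"
    by (rule norm_triangle_ineq4)
  also have "\<dots> \<le> norm f * norm (pprt x) + norm f * norm (pprt (- x))"
    by (intro add_mono norm_rk_le) auto
  also have "\<dots> \<le> norm f * norm x + norm f * norm x"
    using norm_pprt_le[of x] norm_pprt_le[of "- x"] by (intro add_mono mult_left_mono) auto
  finally show "norm (?L x) \<le> norm x * (norm f + norm f)" by (simp add: algebra_simps)
qed

lemma blinfun_pos_apply: "0 \<le> x \<Longrightarrow> blinfun_apply (blinfun_pos f) x = rk_pos f x"
  unfolding blinfun_pos_def bounded_linear_Blinfun_apply[OF bounded_linear_rk]
  using rk_diff[of x 0 x] rk_add[of 0 0] by simp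

lemma blinfun_pos_ge: "f \<le> blinfun_pos f" "0 \<le> blinfun_pos f"
  by (auto simp: less_eq_blinfun_def blinfun_pos_apply rk_nonneg intro: rk_upper)

lemma blinfun_pos_least:
  assumes "f \<le> g" "0 \<le> g" shows "blinfun_pos f \<le> g"
  unfolding less_eq_blinfun_def
proof (intro allI impI)
  fix x :: 'a assume x: "0 \<le> x"
  have "rk_pos f x \<le> blinfun_apply g x"
  proof (rule rk_least[OF x])
    fix y assume y: "0 \<le> y" "y \<le> x"
    have "blinfun_apply f y \<le> blinfun_apply g y"
      using assms y by (simp add: less_eq_blinfun_def)
    also have "\<dots> \<le> blinfun_apply g y + blinfun_apply g (x - y)"
      using assms y by (simp add: less_eq_blinfun_def)
    finally show "blinfun_apply f y \<le> blinfun_apply g x"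
      by (simp add: blinfun.diff_right)
  qed
  then show "blinfun_apply (blinfun_pos f) x \<le> blinfun_apply g x"
    using x by (simp add: blinfun_pos_apply)
qed

end

subsection \<open>The Banach lattice instance\<close>

instantiation blinfun :: (banach_lattice, unital_banach_lattice) lattice_ab_group_add_abs
begin

definition sup_blinfun :: "('a \<Rightarrow>\<^sub>L 'b) \<Rightarrow> ('a \<Rightarrow>\<^sub>L 'b) \<Rightarrow> 'a \<Rightarrow>\<^sub>L 'b" where
  "sup f g = f + blinfun_pos (g - f)"

definition inf_blinfun :: "('a \<Rightarrow>\<^sub>L 'b) \<Rightarrow> ('a \<Rightarrow>\<^sub>L 'b) \<Rightarrow> 'a \<Rightarrow>\<^sub>L 'b" where
  "inf f g = f - blinfun_pos (f - g)"

definition abs_blinfun :: "('a \<Rightarrow>\<^sub>L 'b) \<Rightarrow> 'a \<Rightarrow>\<^sub>L 'b" where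
  "abs_blinfun f = sup f (- f)"

instance
proof
  fix f g h :: "'a \<Rightarrow>\<^sub>L 'b"
  show "\<bar>f\<bar> = sup f (- f)" by (rule abs_blinfun_def)
  show "f \<le> sup f g" using blinfun_pos_ge[of "g - f"] by (simp add: sup_blinfun_def)
  show "g \<le> sup f g" using blinfun_pos_ge[of "g - f"]
    by (simp add: sup_blinfun_def algebra_simps)
  show "sup g h \<le> f" if "g \<le> f" "h \<le> f"
    using blinfun_pos_least[of "h - g" "f - g"] that by (simp add: sup_blinfun_def algebra_simps)
  show "inf f g \<le> f" using blinfun_pos_ge[of "f - g"] by (simp add: inf_blinfun_def)
  show "inf f g \<le> g" using blinfun_pos_ge[of "f - g"]
    by (simp add: inf_blinfun_def algebra_simps)
  show "f \<le> inf g h" if "f \<le> g" "f \<le> h"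
    using blinfun_pos_least[of "g - h" "g - f"] that by (simp add: inf_blinfun_def algebra_simps)
qed

end

lemma blinfun_le_absI:
  fixes f :: "'a::banach_lattice \<Rightarrow>\<^sub>L 'b::unital_banach_lattice"
  shows "blinfun_apply f x \<le> blinfun_apply (\<bar>f\<bar>) (\<bar>x\<bar>)"
proof -
  have 1: "blinfun_apply f y \<le> blinfun_apply \<bar>f\<bar> y" if "0 \<le> y" for y
    using abs_ge_self[of f] that by (simp add: less_eq_blinfun_def)
  have 2: "- blinfun_apply f y \<le> blinfun_apply \<bar>f\<bar> y" if "0 \<le> y" for y
    using abs_ge_minus_self[of f] that by (simp add: less_eq_blinfun_def blinfun.minus_left)
  have "blinfun_apply f x = blinfun_apply f (pprt x) - blinfun_apply f (pprt (- x))"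
    by (simp only: blinfun.diff_right[symmetric] pprt_diff_pprt[symmetric])
  also have "\<dots> \<le> blinfun_apply \<bar>f\<bar> (pprt x) + blinfun_apply \<bar>f\<bar> (pprt (- x))"
    using add_mono[OF 1[of "pprt x"] 2[of "pprt (- x)"]] by simp
  also have "\<dots> = blinfun_apply (\<bar>f\<bar>) (\<bar>x\<bar>)"
    by (simp add: abs_prts pprt_neg blinfun.diff_right blinfun.minus_right)
  finally show ?thesis .
qed

lemma abs_blinfun_le_unit:
  fixes g :: "'a::banach_lattice \<Rightarrow>\<^sub>L 'b::unital_banach_lattice"
  assumes x: "0 \<le> x"
  shows "blinfun_apply \<bar>g\<bar> x \<le> (norm g * norm x) *\<^sub>R strong_unit"
proof -
  have "rk_pos (- g - g) x \<le> (norm g * norm x) *\<^sub>R strong_unit - blinfun_apply g x"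
  proof (rule rk_least[OF x])
    fix y assume y: "0 \<le> y" "y \<le> x"
    have "\<bar>x - (y + y)\<bar> \<le> x"
    proof (rule abs_leI)
      have "0 \<le> y + y" using y by (intro add_nonneg_nonneg)
      then show "x - (y + y) \<le> x" by (simp only: diff_le_eq le_add_same_cancel1)
      show "- (x - (y + y)) \<le> x" using add_mono[OF y(2) y(2)] by (simp add: algebra_simps)
    qed
    then have "norm (x - (y + y)) \<le> norm x"
      using x by (intro norm_mono_abs) (simp add: abs_of_nonneg)
    then have "norm (blinfun_apply g (x - (y + y))) \<le> norm g * norm x"
      using norm_blinfun[of g "x - (y + y)"] by (meson mult_left_mono norm_ge_zero order_trans)
    then have "blinfun_apply g (x - (y + y)) \<le> (norm g * norm x) *\<^sub>R strong_unit"
      by (rule le_norm_unit)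
    then show "blinfun_apply (- g - g) y \<le> (norm g * norm x) *\<^sub>R strong_unit - blinfun_apply g x"
      by (simp add: blinfun.diff_right blinfun.add_right blinfun.diff_left blinfun.minus_left
          algebra_simps)
  qed
  then show ?thesis
    using x by (simp add: abs_blinfun_def sup_blinfun_def blinfun.add_left blinfun_pos_apply
        algebra_simps)
qed

instance blinfun :: (banach_lattice, unital_banach_lattice) banach_lattice
proof
  fix f g :: "'a \<Rightarrow>\<^sub>L 'b" assume le: "\<bar>f\<bar> \<le> \<bar>g\<bar>"
  have *: "blinfun_apply f x \<le> (norm g * norm x) *\<^sub>R strong_unit" for x
  proof -
    note blinfun_le_absI[of f x]
    also have "blinfun_apply (\<bar>f\<bar>) (\<bar>x\<bar>) \<le> blinfun_apply (\<bar>g\<bar>) (\<bar>x\<bar>)"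
      using le by (simp add: less_eq_blinfun_def)
    also have "\<dots> \<le> (norm g * norm x) *\<^sub>R strong_unit"
      using abs_blinfun_le_unit[of "\<bar>x\<bar>" g] by (simp add: norm_abs_eq)
    finally show ?thesis .
  qed
  show "norm f \<le> norm g"
  proof (rule norm_blinfun_bound)
    fix x
    show "norm (blinfun_apply f x) \<le> norm g * norm x"
      using *[of x] *[of "- x"] by (intro norm_le_unitI') (simp_all add: blinfun.minus_right)
  qed simp
qed


section \<open>Sequences and operators\<close>

definition disjoint_seq :: "(nat \<Rightarrow> 'a::banach_lattice) \<Rightarrow> bool" where
  "disjoint_seq x \<longleftrightarrow> (\<forall>m n. m \<noteq> n \<longrightarrow> inf (\<bar>x m\<bar>) (\<bar>x n\<bar>) = 0)"

definition weakly_null :: "(nat \<Rightarrow> 'a::real_normed_vector) \<Rightarrow> bool" where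
  "weakly_null x \<longleftrightarrow> (\<forall>\<phi> :: 'a \<Rightarrow>\<^sub>L real. (\<lambda>n. blinfun_apply \<phi> (x n)) \<longlonglongrightarrow> 0)"

definition weak_star_null :: "(nat \<Rightarrow> 'a::real_normed_vector \<Rightarrow>\<^sub>L real) \<Rightarrow> bool" where
  "weak_star_null \<phi> \<longleftrightarrow> (\<forall>x. (\<lambda>n. blinfun_apply (\<phi> n) x) \<longlonglongrightarrow> 0)"

text \<open>A down-directed set plays the role of a decreasing net, namely itself indexed by itself.\<close>

definition order_continuous_norm :: "'a::banach_lattice itself \<Rightarrow> bool" where
  "order_continuous_norm _ \<longleftrightarrow>
    (\<forall>D :: 'a set. D \<noteq> {} \<longrightarrow> (\<forall>x\<in>D. \<forall>y\<in>D. \<exists>z\<in>D. z \<le> x \<and> z \<le> y) \<longrightarrow>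
      (\<forall>x\<in>D. 0 \<le> x) \<longrightarrow> (\<forall>l. (\<forall>x\<in>D. l \<le> x) \<longrightarrow> l \<le> 0) \<longrightarrow>
      (\<forall>\<epsilon>>0. \<exists>x0\<in>D. \<forall>x\<in>D. x \<le> x0 \<longrightarrow> norm x < \<epsilon>))"

definition dual_positive_schur :: "'f::banach_lattice itself \<Rightarrow> bool" where
  "dual_positive_schur _ \<longleftrightarrow>
    (\<forall>\<phi> :: nat \<Rightarrow> 'f \<Rightarrow>\<^sub>L real. (\<forall>n. 0 \<le> \<phi> n) \<longrightarrow> weak_star_null \<phi> \<longrightarrow> (\<lambda>n. norm (\<phi> n)) \<longlonglongrightarrow> 0)"

definition positive_operator :: "('e::banach_lattice \<Rightarrow> 'f::banach_lattice) \<Rightarrow> bool" where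
  "positive_operator T \<longleftrightarrow> linear T \<and> (\<forall>x\<ge>0. 0 \<le> T x)"

definition almost_dunford_pettis :: "('e::banach_lattice \<Rightarrow> 'x::banach) \<Rightarrow> bool" where
  "almost_dunford_pettis T \<longleftrightarrow> linear T \<and>
    (\<forall>x. disjoint_seq x \<longrightarrow> weakly_null x \<longrightarrow> (\<lambda>n. norm (T (x n))) \<longlonglongrightarrow> 0)"

text \<open>\<^const>\<open>Blinfun\<close> is meaningful here only for bounded \<open>T\<close>.\<close>

definition banach_adjoint ::
    "('x::real_normed_vector \<Rightarrow> 'y::real_normed_vector) \<Rightarrow> ('y \<Rightarrow>\<^sub>L real) \<Rightarrow> ('x \<Rightarrow>\<^sub>L real)" where
  "banach_adjoint T \<phi> = Blinfun (\<lambda>x. blinfun_apply \<phi> (T x))"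

lemma banach_adjoint_apply:
  "bounded_linear T \<Longrightarrow> blinfun_apply (banach_adjoint T \<phi>) x = blinfun_apply \<phi> (T x)"
  unfolding banach_adjoint_def
  by (simp add: bounded_linear_Blinfun_apply blinfun.bounded_linear_right bounded_linear_compose)

text \<open>
  Boundedness is part of the definition because the adjoint presupposes it; a positive operator
  between Banach lattices is automatically bounded.
\<close>

definition positively_limited :: "('x::banach \<Rightarrow> 'f::banach_lattice) \<Rightarrow> bool" where
  "positively_limited T \<longleftrightarrow> bounded_linear T \<and>
    (\<forall>\<phi>. (\<forall>n. 0 \<le> \<phi> n) \<longrightarrow> weak_star_null \<phi> \<longrightarrow> (\<lambda>n. norm (banach_adjoint T (\<phi> n))) \<longlonglongrightarrow> 0)"

end

theory Submission
  imports Defs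
begin

text \<open>
  Both parts pass from the positively limited property of \<open>T\<close> to the almost Dunford--Pettis
  property of its adjoint in the same way. If \<open>\<phi>\<close> is a disjoint weakly null sequence in the
  dual of \<open>F\<close>, then its positive and negative parts are still null against every positive
  functional (\<open>disjoint_weakly_null_pprt\<close>), in particular against evaluation at points of
  \<open>F\<close>. So they are positive weak-star null sequences, their images under the adjoint tend to
  0 in norm, and so does the difference. In (b), positive limitedness is immediate from
  \<open>\<parallel>T\<^sup>*\<phi>\<parallel> \<le> \<parallel>\<phi>\<parallel> \<parallel>T\<parallel>\<close>.

  In (a), suppose that \<open>\<phi>\<close> is positive and weak-star null but that \<open>\<psi> n = T\<^sup>*(\<phi> n)\<close> does
  not tend to 0 in norm. A Dodds--Fremlin disjointification produces positive disjoint vectors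
  \<open>x k\<close> in the unit ball of \<open>E\<close> at which a subsequence of \<open>\<psi>\<close> stays bounded away from 0
  (\<open>disjoint_witness_of_not_norm_null\<close>). Order continuity of the dual norm makes every bounded
  disjoint positive sequence weakly null (\<open>order_continuous_dual_disjoint_weakly_null\<close>), hence
  \<open>T (x k)\<close> tends to 0 in norm; the functionals \<open>\<phi> n\<close> are uniformly bounded, hence their values
  at \<open>T (x k)\<close> tend to 0, a contradiction.

  The two statements about disjoint sequences rest on one construction. For a positive
  functional \<open>f\<close> and a solid cone \<open>A\<close> of positive vectors, the map
  \<open>x \<mapsto> sup {f z | 0 \<le> z \<le> x, z \<in> A}\<close> is additive on the positive cone and extends to a bounded
  functional \<open>h\<close> (\<open>ex_cone_component\<close>). It agrees with \<open>f\<close> on \<open>A\<close>, vanishes at positive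
  vectors disjoint from \<open>A\<close>, and is the smallest positive functional that dominates \<open>f\<close> on \<open>A\<close>.
\<close>

section \<open>Order and norm in a Banach lattice\<close>

lemma abs_eq_pprt_add: "\<bar>x\<bar> = pprt x + pprt (- x)"
  for x :: "'a::lattice_ab_group_add_abs"
  by (simp add: abs_prts pprt_neg)

lemma inf_pprt_pprt_uminus: "inf (pprt x) (pprt (- x)) = 0"
  for x :: "'a::lattice_ab_group_add"
proof -
  have "inf (pprt x) (pprt (- x)) = inf (pprt (- x) + x) (pprt (- x) + 0)"
    using pprt_diff_pprt[of x] by (simp add: algebra_simps)
  also have "\<dots> = pprt (- x) + inf x 0"
    by (simp only: add_inf_distrib_left)
  also have "\<dots> = 0"
    by (simp add: pprt_neg flip: nprt_def)
  finally show ?thesis .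
qed

lemma inf_eq_0_mono:
  fixes a b c d :: "'a::lattice_ab_group_add"
  assumes "inf c d = 0" "0 \<le> a" "a \<le> c" "0 \<le> b" "b \<le> d"
  shows "inf a b = 0"
proof (rule antisym)
  show "inf a b \<le> 0"
    using inf_mono[OF assms(3,5)] assms(1) by simp
  show "0 \<le> inf a b"
    using assms(2,4) by simp
qed

lemma inf_add_eq_0:
  fixes a b v :: "'a::lattice_ab_group_add"
  assumes "0 \<le> a" "0 \<le> b" "0 \<le> v" "inf a v = 0" "inf b v = 0"
  shows "inf (a + b) v = 0"
proof -
  have "inf (a + b) v - a \<le> inf b v"
  proof (rule le_infI)
    show "inf (a + b) v - a \<le> b"
      by (simp add: diff_le_eq add.commute)
    have "inf (a + b) v \<le> v + a"
      using assms(1) by (meson add_increasing2 inf_le2 order_refl order_trans)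
    then show "inf (a + b) v - a \<le> v"
      by (simp add: diff_le_eq)
  qed
  then have "inf (a + b) v \<le> a"
    by (simp only: assms(5) diff_le_eq add_0)
  then have "inf (a + b) v \<le> inf a v"
    by (intro le_infI inf_le2)
  then have "inf (a + b) v \<le> 0"
    by (simp only: assms(4))
  moreover have "0 \<le> inf (a + b) v"
    using assms by simp
  ultimately show ?thesis
    by (rule antisym)
qed

text \<open>
  Enlarging \<open>c\<close> to \<open>d \<ge> 1\<close> and then \<open>v\<close> to \<open>d *\<^sub>R v\<close> scales both arguments by the same factor.
\<close>

lemma inf_scaleR_eq_0:
  fixes a v :: "'a::banach_lattice"
  assumes "0 \<le> a" "0 \<le> v" "inf a v = 0" "0 \<le> c"
  shows "inf (c *\<^sub>R a) v = 0"
proof -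
  define d where "d = max c 1"
  have d: "c \<le> d" "1 \<le> d"
    by (auto simp: d_def)
  have "(1 / d) *\<^sub>R inf (d *\<^sub>R a) (d *\<^sub>R v) \<le> inf a v"
  proof (rule le_infI)
    show "(1 / d) *\<^sub>R inf (d *\<^sub>R a) (d *\<^sub>R v) \<le> a"
      using d scaleR_left_mono[OF inf_le1, of "1 / d" "d *\<^sub>R a" "d *\<^sub>R v"] by simp
    show "(1 / d) *\<^sub>R inf (d *\<^sub>R a) (d *\<^sub>R v) \<le> v"
      using d scaleR_left_mono[OF inf_le2, of "1 / d" "d *\<^sub>R a" "d *\<^sub>R v"] by simp
  qed
  then have "d *\<^sub>R ((1 / d) *\<^sub>R inf (d *\<^sub>R a) (d *\<^sub>R v)) \<le> d *\<^sub>R 0"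
    using d assms(3) by (intro scaleR_left_mono) auto
  then have "inf (d *\<^sub>R a) (d *\<^sub>R v) = 0"
    using d assms by (intro antisym) (auto intro: scaleR_nonneg_nonneg)
  moreover have "v \<le> d *\<^sub>R v"
    using scaleR_right_mono[OF d(2) assms(2)] by simp
  ultimately show ?thesis
    using assms d by (elim inf_eq_0_mono) (auto intro: scaleR_right_mono scaleR_nonneg_nonneg)
qed

lemma member_le_sum_nonneg:
  fixes x :: "'i \<Rightarrow> 'a::ordered_comm_monoid_add"
  assumes "n \<in> I" "finite I" "\<And>i. i \<in> I \<Longrightarrow> 0 \<le> x i"
  shows "x n \<le> sum x I"
  using sum_mono2[of I "{n}" x] assms by auto

text \<open>
  The negative part of the limit \<open>l\<close> is dominated by \<open>\<bar>x n - l\<bar>\<close>, so its norm is 0.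
\<close>

lemma LIMSEQ_nonneg_banach_lattice:
  fixes x :: "nat \<Rightarrow> 'a::banach_lattice"
  assumes "x \<longlonglongrightarrow> l" "\<And>n. 0 \<le> x n"
  shows "0 \<le> l"
proof -
  have "norm (pprt (- l)) \<le> norm (x n - l)" for n
  proof -
    have "- l \<le> x n - l"
      using assms(2)[of n] by simp
    then have "pprt (- l) \<le> \<bar>x n - l\<bar>"
      unfolding pprt_def by (meson abs_ge_self abs_ge_zero le_supI order_trans)
    from norm_mono_pos[OF _ this] show ?thesis
      by (simp add: norm_abs_eq)
  qed
  moreover have "(\<lambda>n. norm (x n - l)) \<longlonglongrightarrow> 0"
    using assms(1) by (simp add: LIM_zero tendsto_norm_zero)
  ultimately have "norm (pprt (- l)) \<le> 0"
    by (intro LIMSEQ_le_const) auto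
  then have "pprt (- l) = 0"
    by simp
  then show ?thesis
    by (metis neg_le_0_iff_le le_iff_sup pprt_def sup.commute)
qed

text \<open>
  The sum of the series is such a bound. Uniform boundedness of positive operators and the
  disjointification of a sequence both reduce to this choice of one vector above all scaled terms.
\<close>

lemma summable_imp_upper_bound:
  fixes x :: "nat \<Rightarrow> 'a::banach_lattice"
  assumes nonneg: "\<And>n. 0 \<le> x n" and summable: "summable (\<lambda>n. norm (x n))"
  obtains y where "0 \<le> y" "\<And>n. x n \<le> y"
proof
  have lim: "(\<lambda>n. \<Sum>i<n. x i) \<longlonglongrightarrow> suminf x"
    using summable_norm_cancel[OF summable] by (rule summable_LIMSEQ)
  show "0 \<le> suminf x"
    by (rule LIMSEQ_nonneg_banach_lattice[OF lim]) (simp add: sum_nonneg nonneg)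
  fix n
  have "(\<lambda>k. (\<Sum>i<k + Suc n. x i) - x n) \<longlonglongrightarrow> suminf x - x n"
    by (intro tendsto_diff tendsto_const LIMSEQ_ignore_initial_segment lim)
  moreover have "0 \<le> (\<Sum>i<k + Suc n. x i) - x n" for k
    using member_le_sum_nonneg[of n "{..<k + Suc n}" x] nonneg by simp
  ultimately have "0 \<le> suminf x - x n"
    by (rule LIMSEQ_nonneg_banach_lattice)
  then show "x n \<le> suminf x"
    by simp
qed

section \<open>Positive operators\<close>

lemma positive_operator_mono:
  assumes "positive_operator T" "x \<le> y"
  shows "T x \<le> T y"
proof -
  have "linear T" and "0 \<le> T (y - x)"
    using assms by (simp_all add: positive_operator_def)
  then show ?thesis
    by (simp add: linear_diff)
qed

text \<open>
  Otherwise there are positive \<open>x k\<close> of norm at most \<open>(1/2)^k\<close> and operators \<open>T (i k)\<close> with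
  \<open>\<parallel>T (i k) (x k)\<parallel> \<ge> k\<close>. By monotonicity the family is then unbounded at a common upper bound of
  the \<open>x k\<close>. A single operator gives automatic continuity, and a pointwise convergent sequence of
  functionals gives the uniform boundedness principle in the form used below.
\<close>

lemma positive_operator_family_bounded:
  fixes T :: "'i \<Rightarrow> 'e::banach_lattice \<Rightarrow> 'f::banach_lattice"
  assumes pos: "\<And>i. positive_operator (T i)"
    and bdd: "\<And>x. \<exists>B. \<forall>i. norm (T i x) \<le> B"
  shows "\<exists>K\<ge>0. \<forall>i x. 0 \<le> x \<longrightarrow> norm (T i x) \<le> K * norm x"
proof -
  have lin: "linear (T i)" for i
    using pos by (simp add: positive_operator_def)
  show ?thesis
  proof (rule ccontr)
    assume contra: "\<not> ?thesis"
    have "\<exists>i x. 0 \<le> x \<and> norm x \<le> (1/2)^k \<and> real k \<le> norm (T i x)" for k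
    proof -
      obtain i x where ix: "0 \<le> x" "real k * 2^k * norm x < norm (T i x)"
        using contra by (metis mult_nonneg_nonneg not_le of_nat_0_le_iff zero_le_numeral zero_le_power)
      then have x: "0 < norm x"
        using linear_0[OF lin] by (cases "x = 0") auto
      define c where "c = (1/2)^k / norm x"
      have c: "0 < c" "c * norm x = (1/2)^k"
        using x by (simp_all add: c_def)
      have "real k = c * (real k * 2^k * norm x)"
        using x by (simp add: c_def power_one_over)
      also have "\<dots> \<le> c * norm (T i x)"
        using ix c by (intro mult_left_mono) auto
      finally have "real k \<le> norm (T i (c *\<^sub>R x))"
        using c by (simp add: linear_scale[OF lin])
      moreover have "norm (c *\<^sub>R x) \<le> (1/2)^k" "0 \<le> c *\<^sub>R x"
        using c ix by (simp_all add: scaleR_nonneg_nonneg)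
      ultimately show ?thesis
        by blast
    qed
    then obtain i x where x: "\<And>k. 0 \<le> x k" "\<And>k. norm (x k) \<le> (1/2)^k"
      and large: "\<And>k. real k \<le> norm (T (i k) (x k))"
      by metis
    have "summable (\<lambda>k. norm (x k))"
      by (rule summable_comparison_test'[where g = "\<lambda>k. (1/2)^k" and N = 0])
        (simp_all add: x summable_geometric)
    then obtain y where y: "\<And>k. x k \<le> y"
      using summable_imp_upper_bound[of x] x(1) by blast
    obtain B where B: "\<And>i. norm (T i y) \<le> B"
      using bdd by blast
    obtain k where "B < real k"
      using reals_Archimedean2 by blast
    also have "real k \<le> norm (T (i k) (x k))"
      by (rule large)
    also have "\<dots> \<le> norm (T (i k) y)"
      using pos[of "i k"] x(1) positive_operator_mono[OF pos y]
      by (intro norm_mono_pos) (auto simp: positive_operator_def)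
    also have "\<dots> \<le> B"
      by (rule B)
    finally show False
      by simp
  qed
qed

lemma positive_operator_bounded_linear:
  fixes T :: "'e::banach_lattice \<Rightarrow> 'f::banach_lattice"
  assumes pos: "positive_operator T"
  shows "bounded_linear T"
proof -
  have lin: "linear T"
    using pos by (simp add: positive_operator_def)
  obtain K where K: "0 \<le> K" "\<And>x. 0 \<le> x \<Longrightarrow> norm (T x) \<le> K * norm x"
    using positive_operator_family_bounded[of "\<lambda>_::unit. T"] pos by auto
  have "norm (T x) \<le> norm x * (K + K)" for x
  proof -
    have "norm (T x) = norm (T (pprt x) - T (pprt (- x)))"
      by (simp only: linear_diff[OF lin, symmetric] pprt_diff_pprt[symmetric])
    also have "\<dots> \<le> norm (T (pprt x)) + norm (T (pprt (- x)))"
      by (rule norm_triangle_ineq4)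
    also have "\<dots> \<le> K * norm (pprt x) + K * norm (pprt (- x))"
      by (intro add_mono K) auto
    also have "\<dots> \<le> K * norm x + K * norm x"
      using norm_pprt_le[of x] norm_pprt_le[of "- x"] K(1)
      by (intro add_mono mult_left_mono) auto
    finally show ?thesis
      by (simp add: algebra_simps)
  qed
  then show ?thesis
    by (intro bounded_linear_intro[where K = "K + K"])
      (auto simp: linear_add[OF lin] linear_scale[OF lin])
qed

lemma positive_functional_mono:
  fixes f :: "'a::banach_lattice \<Rightarrow>\<^sub>L real"
  assumes "0 \<le> f" "x \<le> y"
  shows "blinfun_apply f x \<le> blinfun_apply f y"
proof -
  have "0 \<le> blinfun_apply f (y - x)"
    using assms by (simp add: less_eq_blinfun_def)
  then show ?thesis
    by (simp add: blinfun.diff_right)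
qed

lemma weak_star_null_positive_imp_bounded:
  fixes \<phi> :: "nat \<Rightarrow> 'f::banach_lattice \<Rightarrow>\<^sub>L real"
  assumes "\<And>n. 0 \<le> \<phi> n" "weak_star_null \<phi>"
  obtains K where "\<And>n x. 0 \<le> x \<Longrightarrow> blinfun_apply (\<phi> n) x \<le> K * norm x"
proof -
  have "positive_operator (blinfun_apply (\<phi> n))" for n
    using assms(1)[of n]
    by (auto simp: positive_operator_def less_eq_blinfun_def
        intro: bounded_linear.linear blinfun.bounded_linear_right)
  moreover have "\<exists>B. \<forall>n. norm (blinfun_apply (\<phi> n) x) \<le> B" for x
  proof -
    have "(\<lambda>n. blinfun_apply (\<phi> n) x) \<longlonglongrightarrow> 0"
      using assms(2) by (simp add: weak_star_null_def)
    then have "Bseq (\<lambda>n. blinfun_apply (\<phi> n) x)"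
      by (intro convergent_imp_Bseq convergentI)
    then show ?thesis
      by (auto simp: Bseq_def)
  qed
  ultimately obtain K where "\<And>n x. 0 \<le> x \<Longrightarrow> norm (blinfun_apply (\<phi> n) x) \<le> K * norm x"
    using positive_operator_family_bounded[of "\<lambda>n. blinfun_apply (\<phi> n)"] by blast
  then show ?thesis
    using that by (metis abs_le_D1 real_norm_def)
qed

text \<open>
  The absolute value of a vector at which \<open>f\<close> is large can be taken, as \<open>\<bar>f x\<bar> \<le> f \<bar>x\<bar>\<close>.
\<close>

lemma norm_positive_functional_gtD:
  fixes f :: "'a::banach_lattice \<Rightarrow>\<^sub>L real"
  assumes "0 \<le> f" "e < norm f" "0 \<le> e"
  obtains y where "0 \<le> y" "norm y \<le> 1" "e < blinfun_apply f y"
proof -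
  obtain x where x: "e * norm x < \<bar>blinfun_apply f x\<bar>"
    using assms norm_blinfun_bound[of e f] by (metis not_le real_norm_def)
  then have nx: "0 < norm x"
    by (cases "x = 0") auto
  have "\<bar>blinfun_apply f x\<bar> \<le> blinfun_apply f \<bar>x\<bar>"
    using blinfun_le_absI[of f x] blinfun_le_absI[of f "- x"] assms(1)
    by (simp add: blinfun.minus_right abs_of_nonneg abs_le_iff)
  with x have *: "e * norm x < blinfun_apply f \<bar>x\<bar>"
    by simp
  show ?thesis
  proof
    show "0 \<le> (1 / norm x) *\<^sub>R \<bar>x\<bar>"
      by (simp add: scaleR_nonneg_nonneg)
    show "norm ((1 / norm x) *\<^sub>R \<bar>x\<bar>) \<le> 1"
      using nx by (simp add: norm_abs_eq)
    show "e < blinfun_apply f ((1 / norm x) *\<^sub>R \<bar>x\<bar>)"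
      using * nx by (simp add: blinfun.scaleR_right field_simps)
  qed
qed

section \<open>Restricting a positive functional to a solid cone\<close>

text \<open>
  Kantorovich's extension: \<open>h u - h v\<close> depends only on \<open>u - v\<close>, so \<open>h\<close> extends linearly by
  means of the decomposition of a vector into its positive and negative parts.
\<close>

lemma extend_from_positive_cone:
  fixes h :: "'a::banach_lattice \<Rightarrow> 'b::real_normed_vector"
  assumes add: "\<And>x y. 0 \<le> x \<Longrightarrow> 0 \<le> y \<Longrightarrow> h (x + y) = h x + h y"
    and scale: "\<And>c x. 0 < c \<Longrightarrow> 0 \<le> x \<Longrightarrow> h (c *\<^sub>R x) = c *\<^sub>R h x"
    and bound: "\<And>x. 0 \<le> x \<Longrightarrow> norm (h x) \<le> K * norm x" and K: "0 \<le> K"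
  obtains H where "\<And>x. 0 \<le> x \<Longrightarrow> blinfun_apply H x = h x"
proof
  let ?L = "\<lambda>x. h (pprt x) - h (pprt (- x))"
  have diff: "?L (u - v) = h u - h v" if "0 \<le> u" "0 \<le> v" for u v
  proof -
    have "pprt (u - v) + v = u + pprt (- (u - v))"
      using pprt_diff_pprt[of "u - v"] by (metis add_diff_eq diff_add_cancel add.commute)
    then have "h (pprt (u - v)) + h v = h u + h (pprt (- (u - v)))"
      using that by (metis add zero_le_pprt)
    then show ?thesis
      by (simp add: algebra_simps)
  qed
  have bl: "bounded_linear ?L"
  proof (rule bounded_linear_intro[where K = "K + K"])
    fix x y :: 'a and c :: real
    have "x + y = (pprt x - pprt (- x)) + (pprt y - pprt (- y))"
      by (simp only: pprt_diff_pprt[symmetric])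
    then have "x + y = (pprt x + pprt y) - (pprt (- x) + pprt (- y))"
      by (simp add: algebra_simps)
    then have "?L (x + y) = h (pprt x + pprt y) - h (pprt (- x) + pprt (- y))"
      using diff[of "pprt x + pprt y" "pprt (- x) + pprt (- y)"] by (simp add: add_nonneg_nonneg)
    then show "?L (x + y) = ?L x + ?L y"
      by (simp add: add)
    have pos: "?L (c *\<^sub>R x) = c *\<^sub>R ?L x" if "0 < c" for c x
    proof -
      have "c *\<^sub>R x = c *\<^sub>R pprt x - c *\<^sub>R pprt (- x)"
        by (simp only: scaleR_diff_right[symmetric] pprt_diff_pprt[symmetric])
      then have "?L (c *\<^sub>R x) = h (c *\<^sub>R pprt x) - h (c *\<^sub>R pprt (- x))"
        using diff[of "c *\<^sub>R pprt x" "c *\<^sub>R pprt (- x)"] that by (simp add: scaleR_nonneg_nonneg)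
      then show ?thesis
        using that by (simp add: scale scaleR_diff_right)
    qed
    show "?L (c *\<^sub>R x) = c *\<^sub>R ?L x"
    proof (cases c "0::real" rule: linorder_cases)
      case less
      then have "?L ((- c) *\<^sub>R (- x)) = (- c) *\<^sub>R ?L (- x)"
        by (intro pos) simp
      then show ?thesis
        by (simp add: scaleR_diff_right)
    qed (simp_all add: pos)
    have "norm (?L x) \<le> norm (h (pprt x)) + norm (h (pprt (- x)))"
      by (rule norm_triangle_ineq4)
    also have "\<dots> \<le> K * norm (pprt x) + K * norm (pprt (- x))"
      by (intro add_mono bound) auto
    also have "\<dots> \<le> K * norm x + K * norm x"
      using norm_pprt_le[of x] norm_pprt_le[of "- x"] K
      by (intro add_mono mult_left_mono) auto
    finally show "norm (?L x) \<le> norm x * (K + K)"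
      by (simp add: algebra_simps)
  qed
  show "blinfun_apply (Blinfun ?L) x = h x" if "0 \<le> x" for x
    using diff[of x 0] add[of 0 0] that by (simp add: bounded_linear_Blinfun_apply[OF bl])
qed

locale solid_cone =
  fixes A :: "'a::banach_lattice set"
  assumes zero_mem: "0 \<in> A"
    and add_mem: "a \<in> A \<Longrightarrow> b \<in> A \<Longrightarrow> a + b \<in> A"
    and scaleR_mem: "a \<in> A \<Longrightarrow> 0 \<le> c \<Longrightarrow> c *\<^sub>R a \<in> A"
    and down_mem: "a \<in> A \<Longrightarrow> 0 \<le> z \<Longrightarrow> z \<le> a \<Longrightarrow> z \<in> A"

text \<open>
  On the disjoint complement of \<open>V\<close>, the functional constructed below vanishes at every element
  of \<open>V\<close>; this is how sequences are separated from each other.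
\<close>

lemma solid_cone_disjoint_complement:
  fixes V :: "'a::banach_lattice set"
  assumes V: "\<And>v. v \<in> V \<Longrightarrow> 0 \<le> v"
  shows "solid_cone {z. 0 \<le> z \<and> (\<forall>v\<in>V. inf z v = 0)}" (is "solid_cone ?A")
proof
  show "0 \<in> ?A"
    using V by (simp add: inf_absorb1)
  show "a + b \<in> ?A" if "a \<in> ?A" "b \<in> ?A" for a b
    using V that by (simp add: inf_add_eq_0)
  show "c *\<^sub>R a \<in> ?A" if "a \<in> ?A" "0 \<le> c" for a c
    using V that by (simp add: inf_scaleR_eq_0 scaleR_nonneg_nonneg)
  show "z \<in> ?A" if "a \<in> ?A" "0 \<le> z" "z \<le> a" for a z
  proof -
    have "inf z v = 0" if "v \<in> V" for v
    proof (rule inf_eq_0_mono)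
      show "inf a v = 0"
        using \<open>a \<in> ?A\<close> that by simp
    qed (use V that \<open>0 \<le> z\<close> \<open>z \<le> a\<close> in simp_all)
    then show ?thesis
      using that by simp
  qed
qed

lemma solid_cone_Int:
  assumes "solid_cone A" "solid_cone B"
  shows "solid_cone (A \<inter> B)"
proof -
  interpret A: solid_cone A by fact
  interpret B: solid_cone B by fact
  show ?thesis
    by standard
      (auto intro: A.zero_mem A.add_mem A.scaleR_mem A.down_mem
        B.zero_mem B.add_mem B.scaleR_mem B.down_mem)
qed

text \<open>
  The Riesz--Kantorovich formula with the supremum restricted to \<open>A\<close>. For the whole positive cone
  and positive \<open>f\<close> it returns \<open>f\<close>.
\<close>

definition cone_sup :: "('a::banach_lattice \<Rightarrow>\<^sub>L real) \<Rightarrow> 'a set \<Rightarrow> 'a \<Rightarrow> real" where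
  "cone_sup f A x = (SUP z\<in>{0..x} \<inter> A. blinfun_apply f z)"

context
  fixes f :: "'a::banach_lattice \<Rightarrow>\<^sub>L real" and A :: "'a set"
  assumes f: "0 \<le> f" and A: "solid_cone A"
begin

lemma cone_sup_upper: "0 \<le> z \<Longrightarrow> z \<le> x \<Longrightarrow> z \<in> A \<Longrightarrow> blinfun_apply f z \<le> cone_sup f A x"
  unfolding cone_sup_def
  by (rule cSUP_upper, simp, rule bdd_aboveI2[where M = "blinfun_apply f x"])
    (simp add: positive_functional_mono[OF f])

lemma cone_sup_least:
  "0 \<le> x \<Longrightarrow> (\<And>z. 0 \<le> z \<Longrightarrow> z \<le> x \<Longrightarrow> z \<in> A \<Longrightarrow> blinfun_apply f z \<le> c) \<Longrightarrow> cone_sup f A x \<le> c"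
  unfolding cone_sup_def using solid_cone.zero_mem[OF A]
  by (intro cSUP_least) auto

text \<open>
  An element \<open>z \<in> A\<close> below \<open>x + y\<close> splits, by Riesz decomposition, into \<open>inf z x\<close> and
  \<open>z - inf z x\<close>. Solidity keeps both parts in \<open>A\<close>, and closure under sums gives the reverse
  inequality.
\<close>

lemma cone_sup_add:
  assumes x: "0 \<le> x" and y: "0 \<le> y"
  shows "cone_sup f A (x + y) = cone_sup f A x + cone_sup f A y"
proof (rule antisym)
  show "cone_sup f A (x + y) \<le> cone_sup f A x + cone_sup f A y"
  proof (rule cone_sup_least)
    fix z assume z: "0 \<le> z" "z \<le> x + y" "z \<in> A"
    define u where "u = inf z x"
    have u: "0 \<le> u" "u \<le> x" "u \<le> z"
      using z x by (simp_all add: u_def)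
    have v: "z - u \<le> y"
      using z y by (simp add: u_def diff_inf_eq_sup add_sup_distrib_left algebra_simps)
    have "u \<in> A"
      using solid_cone.down_mem[OF A z(3)] u by simp
    moreover have "z - u \<in> A"
    proof -
      have "0 \<le> z - u" "z - u \<le> z"
        using u by simp_all
      then show ?thesis
        using solid_cone.down_mem[OF A z(3)] by simp
    qed
    ultimately have "blinfun_apply f u + blinfun_apply f (z - u) \<le> cone_sup f A x + cone_sup f A y"
      using u v by (intro add_mono cone_sup_upper) auto
    then show "blinfun_apply f z \<le> cone_sup f A x + cone_sup f A y"
      by (simp add: blinfun.diff_right)
  qed (use x y in simp)
  have "cone_sup f A x \<le> cone_sup f A (x + y) - cone_sup f A y"
  proof (rule cone_sup_least[OF x])
    fix u assume u: "0 \<le> u" "u \<le> x" "u \<in> A"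
    have "cone_sup f A y \<le> cone_sup f A (x + y) - blinfun_apply f u"
    proof (rule cone_sup_least[OF y])
      fix v assume v: "0 \<le> v" "v \<le> y" "v \<in> A"
      have "blinfun_apply f (u + v) \<le> cone_sup f A (x + y)"
        using u v by (intro cone_sup_upper add_nonneg_nonneg add_mono solid_cone.add_mem[OF A])
      then show "blinfun_apply f v \<le> cone_sup f A (x + y) - blinfun_apply f u"
        by (simp add: blinfun.add_right algebra_simps)
    qed
    then show "blinfun_apply f u \<le> cone_sup f A (x + y) - cone_sup f A y"
      by simp
  qed
  then show "cone_sup f A x + cone_sup f A y \<le> cone_sup f A (x + y)"
    by simp
qed

lemma cone_sup_scale_le:
  assumes c: "0 < c" and x: "0 \<le> x"
  shows "cone_sup f A (c *\<^sub>R x) \<le> c * cone_sup f A x"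
proof (rule cone_sup_least)
  fix z assume z: "0 \<le> z" "z \<le> c *\<^sub>R x" "z \<in> A"
  have "(1 / c) *\<^sub>R z \<le> (1 / c) *\<^sub>R (c *\<^sub>R x)"
    using z c by (intro scaleR_left_mono) auto
  moreover have "(1 / c) *\<^sub>R z \<in> A"
    using solid_cone.scaleR_mem[OF A z(3)] c by simp
  ultimately have "c * blinfun_apply f ((1 / c) *\<^sub>R z) \<le> c * cone_sup f A x"
    using z c by (intro mult_left_mono cone_sup_upper) (auto intro: scaleR_nonneg_nonneg)
  then show "blinfun_apply f z \<le> c * cone_sup f A x"
    using c by (simp add: blinfun.scaleR_right)
qed (use c x in \<open>simp add: scaleR_nonneg_nonneg\<close>)

lemma cone_sup_scale:
  assumes c: "0 < c" and x: "0 \<le> x"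
  shows "cone_sup f A (c *\<^sub>R x) = c * cone_sup f A x"
proof (rule antisym[OF cone_sup_scale_le[OF assms]])
  have "cone_sup f A ((1 / c) *\<^sub>R (c *\<^sub>R x)) \<le> (1 / c) * cone_sup f A (c *\<^sub>R x)"
    using c x by (intro cone_sup_scale_le) (auto intro: scaleR_nonneg_nonneg)
  then show "c * cone_sup f A x \<le> cone_sup f A (c *\<^sub>R x)"
    using c by (simp add: field_simps)
qed

lemma ex_cone_component:
  obtains h :: "'a \<Rightarrow>\<^sub>L real"
  where "0 \<le> h" "\<And>x. 0 \<le> x \<Longrightarrow> blinfun_apply h x = cone_sup f A x"
    "\<And>x. 0 \<le> x \<Longrightarrow> x \<in> A \<Longrightarrow> blinfun_apply h x = blinfun_apply f x"
proof -
  have nonneg: "0 \<le> cone_sup f A x" if "0 \<le> x" for x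
    using cone_sup_upper[of 0 x] that solid_cone.zero_mem[OF A] by simp
  have le: "cone_sup f A x \<le> blinfun_apply f x" if "0 \<le> x" for x
    using that by (intro cone_sup_least positive_functional_mono[OF f])
  have "norm (cone_sup f A x) \<le> norm f * norm x" if "0 \<le> x" for x
    using le[OF that] nonneg[OF that] norm_blinfun[of f x] by simp
  then obtain h where h: "\<And>x. 0 \<le> x \<Longrightarrow> blinfun_apply h x = cone_sup f A x"
    using extend_from_positive_cone[of "cone_sup f A" "norm f"]
    by (metis cone_sup_add cone_sup_scale norm_ge_zero real_scaleR_def)
  show ?thesis
  proof
    show "0 \<le> h"
      using nonneg by (simp add: less_eq_blinfun_def h)
    show "blinfun_apply h x = blinfun_apply f x" if "0 \<le> x" "x \<in> A" for x
      using le[OF that(1)] cone_sup_upper[of x x] that by (simp add: h antisym)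
  qed (rule h)
qed

end

section \<open>Disjoint sequences\<close>

text \<open>
  There is one functional \<open>h\<close> with \<open>h (x n) = f (pprt (x n))\<close> for all \<open>n\<close> at once, so the claim
  is weak convergence against \<open>h\<close>. Take the component of \<open>f\<close> on the disjoint complement of all the
  negative parts \<open>pprt (- x m)\<close>: disjointness of the sequence puts every \<open>pprt (x n)\<close> into that
  complement, and \<open>h\<close> vanishes at the negative parts.
\<close>

lemma disjoint_weakly_null_pprt:
  fixes x :: "nat \<Rightarrow> 'a::banach_lattice"
    and f :: "'a \<Rightarrow>\<^sub>L real"
  assumes disj: "disjoint_seq x" and null: "weakly_null x" and f: "0 \<le> f"
  shows "(\<lambda>n. blinfun_apply f (pprt (x n))) \<longlonglongrightarrow> 0"
proof -
  define V where "V = range (\<lambda>n. pprt (- x n))"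
  define A where "A = {z. 0 \<le> z \<and> (\<forall>v\<in>V. inf z v = 0)}"
  have A: "solid_cone A"
    unfolding A_def by (rule solid_cone_disjoint_complement) (auto simp: V_def)
  have pos: "pprt (x n) \<in> A" for n
  proof -
    have "inf (pprt (x n)) (pprt (- x m)) = 0" for m
    proof (cases "m = n")
      case False
      then have "inf \<bar>x n\<bar> \<bar>x m\<bar> = 0"
        using disj by (simp add: disjoint_seq_def)
      then show ?thesis
        by (rule inf_eq_0_mono) (simp_all add: abs_eq_pprt_add)
    qed (simp add: inf_pprt_pprt_uminus)
    then show ?thesis
      by (auto simp: A_def V_def)
  qed
  obtain h :: "'a \<Rightarrow>\<^sub>L real" where h: "0 \<le> h"
    "\<And>x. 0 \<le> x \<Longrightarrow> blinfun_apply h x = cone_sup f A x"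
    "\<And>x. 0 \<le> x \<Longrightarrow> x \<in> A \<Longrightarrow> blinfun_apply h x = blinfun_apply f x"
    using ex_cone_component[OF f A] by blast
  have neg: "blinfun_apply h (pprt (- x n)) = 0" for n
  proof (rule antisym)
    have "cone_sup f A (pprt (- x n)) \<le> 0"
    proof (rule cone_sup_least[OF f A])
      fix z assume z: "0 \<le> z" "z \<le> pprt (- x n)" "z \<in> A"
      then have "z = inf z (pprt (- x n))"
        by (simp add: inf_absorb1)
      also have "\<dots> = 0"
        using z by (auto simp: A_def V_def)
      finally show "blinfun_apply f z \<le> 0"
        by simp
    qed simp
    then show "blinfun_apply h (pprt (- x n)) \<le> 0"
      by (simp add: h)
    show "0 \<le> blinfun_apply h (pprt (- x n))"
      using h(1) by (simp add: less_eq_blinfun_def)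
  qed
  have "blinfun_apply h (x n) = blinfun_apply f (pprt (x n))" for n
  proof -
    have "blinfun_apply h (x n) = blinfun_apply h (pprt (x n)) - blinfun_apply h (pprt (- x n))"
      by (simp only: blinfun.diff_right[symmetric] pprt_diff_pprt[symmetric])
    then show ?thesis
      using h(3)[OF zero_le_pprt pos] by (simp add: neg)
  qed
  then show ?thesis
    using null[unfolded weakly_null_def, rule_format, of h] by simp
qed

text \<open>
  For positive \<open>f\<close> let \<open>h n\<close> be the component of \<open>f\<close> on a solid cone \<open>A n\<close> that contains
  \<open>x i\<close> for \<open>i \<ge> n\<close> and is disjoint from \<open>x i\<close> for \<open>i < n\<close>. If the decreasing sequence \<open>h\<close> has
  infimum 0, then order continuity gives \<open>\<parallel>h n\<parallel> \<longlonglongrightarrow> 0\<close>, and \<open>f (x n) = h n (x n)\<close> tends to 0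
  because \<open>x\<close> is bounded. The infimum need not be 0 when the cones are full disjoint complements,
  because a functional may live away from all the \<open>x i\<close>; the cones are therefore cut down to the
  set \<open>G\<close> below.
\<close>

lemma order_continuous_dual_disjoint_weakly_null:
  fixes x :: "nat \<Rightarrow> 'a::banach_lattice"
  assumes oc: "order_continuous_norm TYPE('a \<Rightarrow>\<^sub>L real)"
    and disj: "disjoint_seq x" and nonneg: "\<And>n. 0 \<le> x n" and bdd: "\<And>n. norm (x n) \<le> B"
  shows "weakly_null x"
proof -
  have "(\<lambda>n. blinfun_apply f (x n)) \<longlonglongrightarrow> 0" if f: "0 \<le> f" for f :: "'a \<Rightarrow>\<^sub>L real"
  proof -
    \<comment> \<open>\<open>G\<close> is the largest cone determined by the \<open>x i\<close>: a positive functional that vanishes at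
      all \<open>x i\<close> vanishes on it. It stands in for the ideal generated by the \<open>x i\<close>.\<close>
    define G where "G = {z. 0 \<le> z \<and>
      (\<forall>g::'a \<Rightarrow>\<^sub>L real. 0 \<le> g \<longrightarrow> (\<forall>i. blinfun_apply g (x i) = 0) \<longrightarrow> blinfun_apply g z = 0)}"
    define A where "A n = G \<inter> {z. 0 \<le> z \<and> (\<forall>v\<in>x ` {..<n}. inf z v = 0)}" for n
    have G: "solid_cone G"
    proof -
      have "blinfun_apply g z = 0"
        if "0 \<le> g" "blinfun_apply g a = 0" "0 \<le> z" "z \<le> a" for g :: "'a \<Rightarrow>\<^sub>L real" and a z
        using positive_functional_mono[OF that(1,3)] positive_functional_mono[OF that(1,4)] that(2)
        by simp
      then show ?thesis
        unfolding G_def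
        by unfold_locales (auto simp: blinfun.add_right blinfun.scaleR_right scaleR_nonneg_nonneg)
    qed
    have A: "solid_cone (A n)" for n
      unfolding A_def using nonneg
      by (intro solid_cone_Int G solid_cone_disjoint_complement) auto
    have "\<exists>h::'a \<Rightarrow>\<^sub>L real. 0 \<le> h \<and> (\<forall>x\<ge>0. blinfun_apply h x = cone_sup f (A n) x) \<and>
       (\<forall>x\<ge>0. x \<in> A n \<longrightarrow> blinfun_apply h x = blinfun_apply f x)" for n
      by (rule ex_cone_component[OF f A[of n]]) blast
    then obtain h :: "nat \<Rightarrow> 'a \<Rightarrow>\<^sub>L real" where h: "\<And>n. 0 \<le> h n"
      "\<And>n x. 0 \<le> x \<Longrightarrow> blinfun_apply (h n) x = cone_sup f (A n) x"
      "\<And>n x. 0 \<le> x \<Longrightarrow> x \<in> A n \<Longrightarrow> blinfun_apply (h n) x = blinfun_apply f x"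
      by metis
    have in_A: "x i \<in> A n" if "n \<le> i" for i n
      using disj that nonneg by (auto simp: A_def G_def disjoint_seq_def abs_of_nonneg)
    have h_le: "blinfun_apply (h n) y \<le> c"
      if "0 \<le> y" "\<And>z. 0 \<le> z \<Longrightarrow> z \<le> y \<Longrightarrow> z \<in> A n \<Longrightarrow> blinfun_apply f z \<le> c" for n y c
      unfolding h(2)[OF that(1)] using that by (rule cone_sup_least[OF f A])
    have h_ge: "blinfun_apply f z \<le> blinfun_apply (h n) y"
      if "0 \<le> z" "z \<le> y" "z \<in> A n" for n y z
      unfolding h(2)[OF order_trans[OF that(1,2)]] using that by (rule cone_sup_upper[OF f A])
    have antimono: "h n \<le> h m" if "m \<le> n" for m n
      unfolding less_eq_blinfun_def
    proof (intro allI impI)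
      fix y :: 'a assume "0 \<le> y"
      then show "blinfun_apply (h n) y \<le> blinfun_apply (h m) y"
        using that by (intro h_le h_ge) (auto simp: A_def)
    qed
    have h_zero: "blinfun_apply (h (Suc i)) (x i) \<le> 0" for i
    proof (rule h_le[OF nonneg])
      fix z assume z: "0 \<le> z" "z \<le> x i" "z \<in> A (Suc i)"
      then have "z = inf z (x i)"
        by (simp add: inf_absorb1)
      also have "\<dots> = 0"
        using z by (auto simp: A_def)
      finally show "blinfun_apply f z \<le> 0"
        by simp
    qed
    \<comment> \<open>A positive \<open>g\<close> below all \<open>h n\<close> vanishes at every \<open>x i\<close>, hence on \<open>G\<close>. Then \<open>h 0 - g\<close>
      is positive and still equals \<open>f\<close> on \<open>A 0\<close>, so minimality of \<open>h 0\<close> forces \<open>g = 0\<close>.\<close>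
    have inf_zero: "l \<le> 0" if l: "\<And>n. l \<le> h n" for l
    proof -
      define g where "g = sup l 0"
      have g: "0 \<le> g" "g \<le> h n" for n
        using l h(1) by (simp_all add: g_def)
      have "blinfun_apply g (x i) = 0" for i
      proof -
        have "blinfun_apply g (x i) \<le> blinfun_apply (h (Suc i)) (x i)"
          using g(2) nonneg by (simp add: less_eq_blinfun_def)
        moreover have "0 \<le> blinfun_apply g (x i)"
          using g(1) nonneg by (simp add: less_eq_blinfun_def)
        ultimately show ?thesis
          using h_zero[of i] by linarith
      qed
      then have g_G: "blinfun_apply g z = 0" if "z \<in> G" for z
        using that g(1) by (auto simp: G_def)
      have "h 0 \<le> h 0 - g"
        unfolding less_eq_blinfun_def
      proof (intro allI impI h_le)
        fix y z assume z: "0 \<le> z" "z \<le> y" "z \<in> A 0"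
        then have "blinfun_apply f z = blinfun_apply (h 0 - g) z"
          using g_G[of z] h(3)[of z 0] by (simp add: A_def blinfun.diff_left)
        also have "\<dots> \<le> blinfun_apply (h 0 - g) y"
          using g(2)[of 0] z by (intro positive_functional_mono) simp_all
        finally show "blinfun_apply f z \<le> blinfun_apply (h 0 - g) y" .
      qed
      then have "g \<le> 0"
        by simp
      then show ?thesis
        by (simp add: g_def)
    qed
    show ?thesis
    proof (rule LIMSEQ_I)
      fix e :: real assume e: "0 < e"
      have B: "0 \<le> B"
        using bdd[of 0] norm_ge_zero[of "x 0"] by linarith
      define d where "d = e / (B + 1)"
      have d: "0 < d"
        using e B by (simp add: d_def)
      have "\<exists>h0\<in>range h. \<forall>k\<in>range h. k \<le> h0 \<longrightarrow> norm k < d"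
      proof -
        have "\<exists>k\<in>range h. k \<le> h m \<and> k \<le> h n" for m n
          using antimono[of m "max m n"] antimono[of n "max m n"] by auto
        then have "\<forall>a\<in>range h. \<forall>b\<in>range h. \<exists>k\<in>range h. k \<le> a \<and> k \<le> b"
          by blast
        moreover have "\<forall>a\<in>range h. 0 \<le> a"
          using h(1) by blast
        moreover have "\<forall>l. (\<forall>a\<in>range h. l \<le> a) \<longrightarrow> l \<le> 0"
          using inf_zero by blast
        ultimately show ?thesis
          using oc d unfolding order_continuous_norm_def by blast
      qed
      then obtain N where N: "\<And>n. h n \<le> h N \<Longrightarrow> norm (h n) < d"
        by auto
      have "norm (blinfun_apply f (x n) - 0) < e" if n: "N \<le> n" for n
      proof -
        have "norm (blinfun_apply f (x n)) = norm (blinfun_apply (h n) (x n))"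
          using h(3)[of "x n" n] nonneg in_A by simp
        also have "\<dots> \<le> norm (h n) * norm (x n)"
          by (rule norm_blinfun)
        also have "\<dots> \<le> d * B"
          using N[OF antimono[OF n]] bdd d by (intro mult_mono) auto
        also have "\<dots> < e"
          using e B by (simp add: d_def field_simps)
        finally show ?thesis
          by simp
      qed
      then show "\<exists>N. \<forall>n\<ge>N. norm (blinfun_apply f (x n) - 0) < e"
        by blast
    qed
  qed
  note pos = this
  show ?thesis
    unfolding weakly_null_def
  proof
    fix f :: "'a \<Rightarrow>\<^sub>L real"
    have "(\<lambda>n. blinfun_apply (pprt f) (x n) - blinfun_apply (pprt (- f)) (x n)) \<longlonglongrightarrow> 0 - 0"
      by (intro tendsto_diff pos) simp_all
    then show "(\<lambda>n. blinfun_apply f (x n)) \<longlonglongrightarrow> 0"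
      by (simp only: blinfun.diff_left[symmetric] pprt_diff_pprt[symmetric] diff_0_right)
  qed
qed

text \<open>
  With \<open>u = a - (1 / c) *\<^sub>R b\<close>, the second vector is the negative part of \<open>c *\<^sub>R u\<close>, which is
  disjoint from the positive part of \<open>u\<close>.
\<close>

lemma disjointify_pair:
  fixes a b :: "'a::banach_lattice"
  assumes "1 \<le> c"
  shows "inf (pprt (a - (1 / c) *\<^sub>R b)) (pprt (b - c *\<^sub>R a)) = 0"
proof -
  let ?u = "a - (1 / c) *\<^sub>R b"
  have eq: "c *\<^sub>R ?u = - (b - c *\<^sub>R a)"
    using assms by (simp add: scaleR_diff_right)
  have "pprt ?u \<le> c *\<^sub>R pprt ?u"
    using scaleR_right_mono[OF assms zero_le_pprt[of ?u]] by simp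
  moreover have "inf (c *\<^sub>R pprt ?u) (c *\<^sub>R pprt (- ?u)) = 0"
  proof -
    have "inf (pprt (- ?u)) (c *\<^sub>R pprt ?u) = 0"
      using assms inf_scaleR_eq_0[OF _ _ inf_pprt_pprt_uminus, of ?u c] by (simp add: inf.commute)
    then show ?thesis
      using assms inf_scaleR_eq_0[of "pprt (- ?u)" "c *\<^sub>R pprt ?u" c]
      by (simp add: inf.commute scaleR_nonneg_nonneg)
  qed
  moreover have "pprt (b - c *\<^sub>R a) \<le> c *\<^sub>R pprt (- ?u)"
  proof -
    have "c *\<^sub>R (- ?u) \<le> c *\<^sub>R pprt (- ?u)"
      using assms by (intro scaleR_left_mono) (auto simp: pprt_def)
    moreover have "c *\<^sub>R (- ?u) = b - c *\<^sub>R a"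
      using eq by (simp only: scaleR_minus_right minus_minus)
    moreover have "0 \<le> c *\<^sub>R pprt (- ?u)"
      using assms by (intro scaleR_nonneg_nonneg) auto
    ultimately show ?thesis
      by (simp add: pprt_def)
  qed
  ultimately show ?thesis
    by (elim inf_eq_0_mono) auto
qed

text \<open>
  For \<open>k < m\<close>, subtracting \<open>(1/2)^k *\<^sub>R w\<close> puts \<open>x k\<close> below the positive part of
  \<open>y k - (1 / c) *\<^sub>R y m\<close> with \<open>c = 2^(k + m)\<close>, and subtracting \<open>4^m\<close> times the earlier terms puts
  \<open>x m\<close> below the positive part of \<open>y m - c *\<^sub>R y k\<close>, since \<open>c \<le> 4^m\<close>. These two bounds are
  disjoint by the preceding lemma.
\<close>

lemma disjointify_seq:
  fixes y :: "nat \<Rightarrow> 'a::banach_lattice"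
  assumes nonneg: "\<And>k. 0 \<le> y k" and w: "\<And>k. (1/2)^k *\<^sub>R y k \<le> w" "0 \<le> w"
  defines "x \<equiv> \<lambda>k. pprt (y k - 4^k *\<^sub>R (\<Sum>i<k. y i) - (1/2)^k *\<^sub>R w)"
  shows "disjoint_seq x"
proof -
  have less: "inf (x k) (x m) = 0" if "k < m" for k m
  proof -
    define c :: real where "c = 2^(k + m)"
    have c: "1 \<le> c" "c \<le> 4^m"
    proof -
      have "c \<le> 2^(m + m)"
        unfolding c_def using that by (intro power_increasing) auto
      also have "\<dots> = (2 * 2)^m"
        by (simp only: power_add power_mult_distrib)
      finally show "c \<le> 4^m"
        by simp
    qed (simp add: c_def)
    have sum: "0 \<le> (\<Sum>i<n. y i)" for n
      by (simp add: sum_nonneg nonneg)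
    have "x k \<le> pprt (y k - (1 / c) *\<^sub>R y m)"
      unfolding x_def
    proof (rule pprt_mono)
      have "(1/2)^k *\<^sub>R ((1/2)^m *\<^sub>R y m) \<le> (1/2)^k *\<^sub>R w"
        by (intro scaleR_left_mono w) simp
      then have "(1 / c) *\<^sub>R y m \<le> (1/2)^k *\<^sub>R w"
        by (simp add: c_def power_add power_one_over)
      moreover have "0 \<le> 4^k *\<^sub>R (\<Sum>i<k. y i)"
        using sum by (intro scaleR_nonneg_nonneg) auto
      ultimately have "(1 / c) *\<^sub>R y m + 0 \<le> (1/2)^k *\<^sub>R w + 4^k *\<^sub>R (\<Sum>i<k. y i)"
        by (rule add_mono)
      then show "y k - 4^k *\<^sub>R (\<Sum>i<k. y i) - (1/2)^k *\<^sub>R w \<le> y k - (1 / c) *\<^sub>R y m"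
        by (simp add: algebra_simps)
    qed
    moreover have "x m \<le> pprt (y m - c *\<^sub>R y k)"
      unfolding x_def
    proof (rule pprt_mono)
      have "c *\<^sub>R y k \<le> 4^m *\<^sub>R y k"
        by (intro scaleR_right_mono c nonneg)
      also have "\<dots> \<le> 4^m *\<^sub>R (\<Sum>i<m. y i)"
        using that nonneg by (intro scaleR_left_mono member_le_sum_nonneg) auto
      finally have "c *\<^sub>R y k + 0 \<le> 4^m *\<^sub>R (\<Sum>i<m. y i) + (1/2)^m *\<^sub>R w"
        using w(2) by (intro add_mono scaleR_nonneg_nonneg) auto
      then show "y m - 4^m *\<^sub>R (\<Sum>i<m. y i) - (1/2)^m *\<^sub>R w \<le> y m - c *\<^sub>R y k"
        by (simp add: algebra_simps)
    qed
    ultimately show ?thesis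
      using disjointify_pair[OF c(1), of "y k" "y m"]
      by (elim inf_eq_0_mono) (auto simp: x_def)
  qed
  have "0 \<le> x k" for k
    by (simp add: x_def)
  then show ?thesis
    unfolding disjoint_seq_def
    by (metis abs_of_nonneg inf.commute less linorder_neqE_nat)
qed

text \<open>
  Choose \<open>y k\<close> in the positive unit ball with \<open>\<psi> (r k) (y k) > e\<close>. Since \<open>\<psi>\<close> is weak-star
  null, \<open>r k\<close> can be chosen so late that \<open>\<psi> (r k)\<close> is small at \<open>4^k\<close> times the sum of the
  earlier \<open>y i\<close>. Disjointifying \<open>y\<close> then costs little in the value of \<open>\<psi> (r k)\<close>.
\<close>

lemma disjoint_witness_of_not_norm_null:
  fixes \<psi> :: "nat \<Rightarrow> 'a::banach_lattice \<Rightarrow>\<^sub>L real"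
  assumes pos: "\<And>n. 0 \<le> \<psi> n" and null: "weak_star_null \<psi>"
    and not_null: "\<not> (\<lambda>n. norm (\<psi> n)) \<longlonglongrightarrow> 0"
  obtains e r and x :: "nat \<Rightarrow> 'a" where "0 < e" "disjoint_seq x" "\<And>k. 0 \<le> x k" "\<And>k. norm (x k) \<le> 1"
    "strict_mono r" "\<forall>\<^sub>F k in sequentially. e \<le> blinfun_apply (\<psi> (r k)) (x k)"
proof -
  obtain e where e: "0 < e" and inf: "\<And>N. \<exists>n\<ge>N. e < norm (\<psi> n)"
  proof -
    obtain d where "0 < d" "\<And>N. \<exists>n\<ge>N. d \<le> norm (\<psi> n)"
      using not_null unfolding LIMSEQ_def dist_real_def by (auto simp: not_less)
    then show ?thesis
      using that[of "d / 2"] by (metis half_gt_zero_iff less_le_trans field_sum_of_halves less_add_same_cancel1)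
  qed
  have "\<exists>y. 0 \<le> y \<and> norm y \<le> 1 \<and> (e < norm (\<psi> n) \<longrightarrow> e < blinfun_apply (\<psi> n) y)" for n
    using norm_positive_functional_gtD[OF pos, of e n] e by (metis less_imp_le norm_zero order_refl zero_le_one)
  then obtain Y where Y: "\<And>n. 0 \<le> Y n" "\<And>n. norm (Y n) \<le> 1"
    "\<And>n. e < norm (\<psi> n) \<Longrightarrow> e < blinfun_apply (\<psi> n) (Y n)"
    by metis
  have wsn: "(\<lambda>n. blinfun_apply (\<psi> n) v) \<longlonglongrightarrow> 0" for v
    using null by (simp add: weak_star_null_def)
  \<comment> \<open>The recursion carries the current index \<open>n\<close> together with the sum \<open>s\<close> of the vectors
    chosen at the earlier stages.\<close>
  define P where "P = (\<lambda>(k::nat) (n::nat, s::'a). e < norm (\<psi> n))"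
  define Q where "Q = (\<lambda>k (n::nat, s::'a) (n'::nat, s'::'a). n < n' \<and> s' = s + Y n \<and>
    blinfun_apply (\<psi> n') (4^Suc k *\<^sub>R s') < e / 4)"
  have "\<exists>F. \<forall>k. (P k (F k) \<and> (k = 0 \<longrightarrow> snd (F k) = 0)) \<and> Q k (F k) (F (Suc k))"
  proof (rule dependent_nat_choice)
    obtain n where "e < norm (\<psi> n)"
      using inf by blast
    then show "\<exists>p. P 0 p \<and> ((0::nat) = 0 \<longrightarrow> snd p = 0)"
      by (intro exI[of _ "(n, 0)"]) (simp add: P_def)
  next
    fix p :: "nat \<times> 'a" and k
    obtain n s where p: "p = (n, s)"
      by (cases p)
    have "\<forall>\<^sub>F n' in sequentially. blinfun_apply (\<psi> n') (4^Suc k *\<^sub>R (s + Y n)) < e / 4"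
      using e by (intro order_tendstoD(2)[OF wsn]) simp
    then obtain N where N: "\<And>n'. N \<le> n' \<Longrightarrow> blinfun_apply (\<psi> n') (4^Suc k *\<^sub>R (s + Y n)) < e / 4"
      unfolding eventually_sequentially by blast
    obtain n' where "max N (Suc n) \<le> n'" "e < norm (\<psi> n')"
      using inf by blast
    then show "\<exists>q. (P (Suc k) q \<and> (Suc k = 0 \<longrightarrow> snd q = 0)) \<and> Q k p q"
      using N by (intro exI[of _ "(n', s + Y n)"]) (simp add: P_def Q_def p)
  qed
  then obtain F where F: "\<And>k. P k (F k)" "snd (F 0) = 0" "\<And>k. Q k (F k) (F (Suc k))"
    by metis
  define r where "r k = fst (F k)" for k
  define y where "y k = Y (r k)" for k
  have large: "e < blinfun_apply (\<psi> (r k)) (y k)" for k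
    using F(1)[of k] Y(3) by (simp add: P_def y_def r_def split_beta)
  have r: "strict_mono r"
    using F(3) by (simp add: strict_mono_Suc_iff Q_def r_def split_beta)
  have s: "snd (F k) = (\<Sum>i<k. y i)" for k
    by (induction k) (use F in \<open>simp_all add: Q_def y_def r_def split_beta\<close>)
  have small: "blinfun_apply (\<psi> (r k)) (4^k *\<^sub>R (\<Sum>i<k. y i)) < e / 4" for k
  proof (cases k)
    case 0
    then show ?thesis
      using e by simp
  next
    case (Suc j)
    then show ?thesis
      using F(3)[of j]
      by (auto simp: Suc Q_def r_def split_beta s[symmetric] simp del: sum.lessThan_Suc power_Suc)
  qed
  have "summable (\<lambda>k. norm ((1/2)^k *\<^sub>R y k))"
  proof (rule summable_comparison_test')
    show "summable (\<lambda>k. (1/2 :: real)^k)"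
      by (simp add: summable_geometric)
    show "norm (norm ((1/2)^k *\<^sub>R y k)) \<le> (1/2)^k" if "0 \<le> k" for k
      using mult_left_le[OF Y(2), of "(1/2)^k"] by (simp add: y_def)
  qed
  moreover have "0 \<le> (1/2)^k *\<^sub>R y k" for k
    by (intro scaleR_nonneg_nonneg) (auto simp: y_def Y)
  ultimately obtain w where w: "0 \<le> w" "\<And>k. (1/2)^k *\<^sub>R y k \<le> w"
    using summable_imp_upper_bound[of "\<lambda>k. (1/2)^k *\<^sub>R y k"] by blast
  define x where "x = (\<lambda>k. pprt (y k - 4^k *\<^sub>R (\<Sum>i<k. y i) - (1/2)^k *\<^sub>R w))"
  have y0: "0 \<le> y k" for k
    by (simp add: y_def Y)
  show ?thesis
  proof
    show "0 < e / 2"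
      using e by simp
    show "disjoint_seq x"
      unfolding x_def using y0 w by (intro disjointify_seq)
    show x0: "0 \<le> x k" for k
      by (simp add: x_def)
    have "x k \<le> y k" for k
    proof -
      have "0 \<le> 4^k *\<^sub>R (\<Sum>i<k. y i) + (1/2)^k *\<^sub>R w"
        using w(1) y0 by (intro add_nonneg_nonneg scaleR_nonneg_nonneg sum_nonneg) auto
      then have "y k - 4^k *\<^sub>R (\<Sum>i<k. y i) - (1/2)^k *\<^sub>R w \<le> y k"
        by (simp add: algebra_simps)
      then show ?thesis
        using y0[of k] by (simp add: x_def pprt_def)
    qed
    then have "norm (x k) \<le> norm (y k)" for k
      using x0 by (intro norm_mono_pos)
    then show "norm (x k) \<le> 1" for k
      using Y(2) by (metis order_trans y_def)
    show "strict_mono r"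
      by (rule r)
    \<comment> \<open>The two subtracted terms cost less than \<open>e / 4\<close> each.\<close>
    have "(\<lambda>k. (1/2)^k * blinfun_apply (\<psi> (r k)) w) \<longlonglongrightarrow> 0 * 0"
      using LIMSEQ_subseq_LIMSEQ[OF wsn r, of w]
      by (intro tendsto_mult LIMSEQ_power_zero) (simp_all add: o_def)
    then have "\<forall>\<^sub>F k in sequentially. (1/2)^k * blinfun_apply (\<psi> (r k)) w < e / 4"
      using e by (intro order_tendstoD(2)) auto
    then show "\<forall>\<^sub>F k in sequentially. e / 2 \<le> blinfun_apply (\<psi> (r k)) (x k)"
    proof eventually_elim
      case (elim k)
      have "e / 2 \<le> blinfun_apply (\<psi> (r k)) (y k - 4^k *\<^sub>R (\<Sum>i<k. y i) - (1/2)^k *\<^sub>R w)"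
        using elim large[of k] small[of k] by (simp add: blinfun.diff_right blinfun.scaleR_right)
      also have "\<dots> \<le> blinfun_apply (\<psi> (r k)) (x k)"
        using pos by (intro positive_functional_mono) (auto simp: x_def pprt_def)
      finally show ?case .
    qed
  qed
qed

section \<open>Positively limited operators\<close>

lemma linear_banach_adjoint:
  assumes "bounded_linear T"
  shows "linear (banach_adjoint T)"
  by (rule linearI; rule blinfun_eqI)
    (simp_all add: banach_adjoint_apply[OF assms] blinfun.add_left blinfun.scaleR_left)

text \<open>
  Evaluation at \<open>y \<ge> 0\<close> is a positive functional on the dual, so the positive parts of a disjoint
  weakly null sequence \<open>\<phi>\<close> are weak-star null. The same holds for \<open>- \<phi>\<close>, and the
  adjoint of \<open>\<phi> n\<close> is the difference of the two images.
\<close>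

lemma positively_limited_imp_adjoint_almost_dunford_pettis:
  fixes T :: "'x::banach \<Rightarrow> 'f::banach_lattice"
  assumes lim: "positively_limited T"
  shows "almost_dunford_pettis (banach_adjoint T)"
  unfolding almost_dunford_pettis_def
proof (intro conjI allI impI)
  have bl: "bounded_linear T"
    using lim by (simp add: positively_limited_def)
  show lin: "linear (banach_adjoint T)"
    by (rule linear_banach_adjoint[OF bl])
  have pprt_null: "(\<lambda>n. norm (banach_adjoint T (pprt (\<phi> n)))) \<longlonglongrightarrow> 0"
    if "disjoint_seq \<phi>" "weakly_null \<phi>" for \<phi>
  proof -
    have pos: "(\<lambda>n. blinfun_apply (pprt (\<phi> n)) y) \<longlonglongrightarrow> 0" if y: "0 \<le> y" for y
    proof -
      define ev where "ev = Blinfun (\<lambda>\<phi>::'f \<Rightarrow>\<^sub>L real. blinfun_apply \<phi> y)"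
      have ev: "blinfun_apply ev \<phi> = blinfun_apply \<phi> y" for \<phi>
        unfolding ev_def by (simp add: bounded_linear_Blinfun_apply blinfun.bounded_linear_left)
      have "0 \<le> ev"
        unfolding less_eq_blinfun_def[of 0 ev] using y by (auto simp: ev less_eq_blinfun_def)
      from disjoint_weakly_null_pprt[OF \<open>disjoint_seq \<phi>\<close> \<open>weakly_null \<phi>\<close> this]
      show ?thesis
        by (simp add: ev)
    qed
    have "weak_star_null (\<lambda>n. pprt (\<phi> n))"
      unfolding weak_star_null_def
    proof
      fix y
      have "(\<lambda>n. blinfun_apply (pprt (\<phi> n)) (pprt y) - blinfun_apply (pprt (\<phi> n)) (pprt (- y)))
        \<longlonglongrightarrow> 0 - 0"
        by (intro tendsto_diff pos) simp_all
      then show "(\<lambda>n. blinfun_apply (pprt (\<phi> n)) y) \<longlonglongrightarrow> 0"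
        by (simp only: blinfun.diff_right[symmetric] pprt_diff_pprt[symmetric] diff_0_right)
    qed
    then show ?thesis
      using lim by (simp add: positively_limited_def)
  qed
  fix \<phi> :: "nat \<Rightarrow> 'f \<Rightarrow>\<^sub>L real"
  assume disj: "disjoint_seq \<phi>" and null: "weakly_null \<phi>"
  have "disjoint_seq (\<lambda>n. - \<phi> n)"
    using disj by (simp add: disjoint_seq_def)
  moreover have "weakly_null (\<lambda>n. - \<phi> n)"
    unfolding weakly_null_def
  proof
    fix \<xi> :: "('f \<Rightarrow>\<^sub>L real) \<Rightarrow>\<^sub>L real"
    have "(\<lambda>n. - blinfun_apply \<xi> (\<phi> n)) \<longlonglongrightarrow> - 0"
      using null by (intro tendsto_minus) (simp add: weakly_null_def)
    then show "(\<lambda>n. blinfun_apply \<xi> (- \<phi> n)) \<longlonglongrightarrow> 0"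
      by (simp add: blinfun.minus_right)
  qed
  ultimately have "(\<lambda>n. norm (banach_adjoint T (pprt (\<phi> n))) + norm (banach_adjoint T (pprt (- \<phi> n))))
    \<longlonglongrightarrow> 0"
    using disj null by (intro tendsto_add_zero pprt_null)
  moreover have "norm (banach_adjoint T (\<phi> n))
    \<le> norm (banach_adjoint T (pprt (\<phi> n))) + norm (banach_adjoint T (pprt (- \<phi> n)))" for n
  proof -
    have "banach_adjoint T (\<phi> n) = banach_adjoint T (pprt (\<phi> n)) - banach_adjoint T (pprt (- \<phi> n))"
      by (simp only: linear_diff[OF lin, symmetric] pprt_diff_pprt[symmetric])
    then show ?thesis
      by (simp add: norm_triangle_ineq4)
  qed
  ultimately have "(\<lambda>n. banach_adjoint T (\<phi> n)) \<longlonglongrightarrow> 0"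
    by (rule Lim_null_comparison[OF always_eventually[OF allI], rotated])
  then show "(\<lambda>n. norm (banach_adjoint T (\<phi> n))) \<longlonglongrightarrow> 0"
    by (rule tendsto_norm_zero)
qed

text \<open>
  If the adjoints of the \<open>\<phi> n\<close> were not norm null, some of them would stay bounded away from 0 at
  a bounded disjoint sequence \<open>x\<close>. This \<open>x\<close> is weakly null, so \<open>T (x k)\<close> is norm null, while the
  \<open>\<phi> n\<close> are uniformly bounded on positive vectors.
\<close>

lemma almost_dunford_pettis_imp_positively_limited:
  fixes T :: "'e::banach_lattice \<Rightarrow> 'f::banach_lattice"
  assumes oc: "order_continuous_norm TYPE('e \<Rightarrow>\<^sub>L real)"
    and T: "positive_operator T" and adp: "almost_dunford_pettis T"
  shows "positively_limited T"
  unfolding positively_limited_def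
proof (intro conjI allI impI)
  show bl: "bounded_linear T"
    by (rule positive_operator_bounded_linear[OF T])
  fix \<phi> :: "nat \<Rightarrow> 'f \<Rightarrow>\<^sub>L real"
  assume "\<forall>n. 0 \<le> \<phi> n" and null: "weak_star_null \<phi>"
  then have pos: "0 \<le> \<phi> n" for n
    by blast
  have adj_pos: "0 \<le> banach_adjoint T (\<phi> n)" for n
    using pos[of n] T
    by (auto simp: less_eq_blinfun_def banach_adjoint_apply[OF bl] positive_operator_def)
  have adj_null: "weak_star_null (\<lambda>n. banach_adjoint T (\<phi> n))"
    using null by (simp add: weak_star_null_def banach_adjoint_apply[OF bl])
  show "(\<lambda>n. norm (banach_adjoint T (\<phi> n))) \<longlonglongrightarrow> 0"
  proof (rule ccontr)
    assume "\<not> ?thesis"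
    with adj_pos adj_null show False
    proof (rule disjoint_witness_of_not_norm_null)
      fix e r and x :: "nat \<Rightarrow> 'e"
      assume e: "0 < e" and x: "disjoint_seq x" "\<And>k. 0 \<le> x k" "\<And>k. norm (x k) \<le> 1"
        and ev: "\<forall>\<^sub>F k in sequentially. e \<le> blinfun_apply (banach_adjoint T (\<phi> (r k))) (x k)"
      obtain K where K: "\<And>n y. 0 \<le> y \<Longrightarrow> blinfun_apply (\<phi> n) y \<le> K * norm y"
        using weak_star_null_positive_imp_bounded[OF pos null] by blast
      have "weakly_null x"
        using order_continuous_dual_disjoint_weakly_null[OF oc x] .
      then have "(\<lambda>k. norm (T (x k))) \<longlonglongrightarrow> 0"
        using adp x(1) by (simp add: almost_dunford_pettis_def)
      then have "(\<lambda>k. K * norm (T (x k))) \<longlonglongrightarrow> K * 0"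
        by (intro tendsto_mult tendsto_const)
      then have "\<forall>\<^sub>F k in sequentially. K * norm (T (x k)) < e"
        using e by (intro order_tendstoD(2)) auto
      with ev have "\<forall>\<^sub>F k in sequentially. False"
      proof eventually_elim
        case (elim k)
        have "0 \<le> T (x k)"
          using T x(2) by (simp add: positive_operator_def)
        then have "blinfun_apply (\<phi> (r k)) (T (x k)) \<le> K * norm (T (x k))"
          by (rule K)
        with elim show False
          by (simp add: banach_adjoint_apply[OF bl])
      qed
      then show False
        by simp
    qed
  qed
qed

lemma dual_positive_schur_imp_positively_limited:
  fixes T :: "'x::banach \<Rightarrow> 'f::banach_lattice"
  assumes schur: "dual_positive_schur TYPE('f)" and bl: "bounded_linear T"
  shows "positively_limited T"
  unfolding positively_limited_def
proof (intro conjI allI impI)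
  fix \<phi> :: "nat \<Rightarrow> 'f \<Rightarrow>\<^sub>L real"
  assume "\<forall>n. 0 \<le> \<phi> n" "weak_star_null \<phi>"
  then have "(\<lambda>n. norm (\<phi> n) * onorm T) \<longlonglongrightarrow> 0"
    using schur by (intro tendsto_mult_left_zero) (simp add: dual_positive_schur_def)
  moreover have "norm (banach_adjoint T (\<phi> n)) \<le> norm (\<phi> n) * onorm T" for n
  proof (rule norm_blinfun_bound)
    fix x
    have "norm (blinfun_apply (\<phi> n) (T x)) \<le> norm (\<phi> n) * norm (T x)"
      by (rule norm_blinfun)
    also have "\<dots> \<le> norm (\<phi> n) * (onorm T * norm x)"
      by (intro mult_left_mono onorm bl) simp
    finally show "norm (blinfun_apply (banach_adjoint T (\<phi> n)) x) \<le> norm (\<phi> n) * onorm T * norm x"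
      by (simp add: banach_adjoint_apply[OF bl] mult.assoc)
  qed (simp add: onorm_pos_le bl)
  ultimately have "(\<lambda>n. banach_adjoint T (\<phi> n)) \<longlonglongrightarrow> 0"
    by (rule Lim_null_comparison[OF always_eventually[OF allI], rotated])
  then show "(\<lambda>n. norm (banach_adjoint T (\<phi> n))) \<longlonglongrightarrow> 0"
    by (rule tendsto_norm_zero)
qed (rule bl)

theorem theorem3p7:
  shows "(order_continuous_norm TYPE('e::banach_lattice \<Rightarrow>\<^sub>L real) \<longrightarrow>
      (\<forall>T :: 'e \<Rightarrow> 'f::banach_lattice. positive_operator T \<and> almost_dunford_pettis T \<longrightarrow>
        positively_limited T \<and> almost_dunford_pettis (banach_adjoint T)))
    \<and> (dual_positive_schur TYPE('f) \<longrightarrow>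
      (\<forall>T :: 'x::banach \<Rightarrow> 'f. bounded_linear T \<longrightarrow>
        positively_limited T \<and> almost_dunford_pettis (banach_adjoint T)))"
proof (intro conjI impI allI; (elim conjE)?)
  fix T :: "'e \<Rightarrow> 'f"
  assume "order_continuous_norm TYPE('e \<Rightarrow>\<^sub>L real)" "positive_operator T" "almost_dunford_pettis T"
  then show "positively_limited T"
    by (rule almost_dunford_pettis_imp_positively_limited)
  then show "almost_dunford_pettis (banach_adjoint T)"
    by (rule positively_limited_imp_adjoint_almost_dunford_pettis)
next
  fix T :: "'x \<Rightarrow> 'f"
  assume "dual_positive_schur TYPE('f)" "bounded_linear T"
  then show "positively_limited T"
    by (rule dual_positive_schur_imp_positively_limited)
  then show "almost_dunford_pettis (banach_adjoint T)"
    by (rule positively_limited_imp_adjoint_almost_dunford_pettis)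
qed

end
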